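(* Let $n\ge 1$ and $T>0$. Let $b\in L^\infty([0,T])$ be real-valued with $b(t)\geq 0$ for all $t\in[0,T]$, and let $a$ be a real-valued function on $[0,T]$ satisfying one of the following conditions: \begin{itemize} \item Case 1: $a\in \mathrm{Lip}([0,T])$ and $\min_{[0,T]}a(t)>0$; \item Case 2: $a\in \mathcal{C}^{\alpha}([0,T])$ with $0<\alpha<1$ and $\min_{[0,T]}a(t)>0$; \item Case 3: $a\in \mathcal{C}^{l}([0,T])$ with $l\ge 2$ and $a(t)\ge 0$ for all $t\in[0,T]$; \item Case 4: $a\in \mathcal{C}^{\alpha}([0,T])$ with $0<\alpha<2$ and $a(t)\ge 0$ for all $t\in[0,T]$. \end{itemize} Then, for each $\hbar>0$, the Cauchy problem $$\begin{cases}\partial_t^2u(t,k)-\hbar^{-2}a(t)\mathcal{L}_\hbar u(t,k)+b(t)u(t,k)=f(t,k),& t\in(0,T],\ k\in\hbar\mathbb{Z}^n,\\ u(0,k)=u_0(k),& k\in\hbar\mathbb{Z}^n,\\ \partial_tu(0,k)=u_1(k),& k\in\hbar\mathbb{Z}^n,\end{cases}$$ is well-posed in $\ell^2(\hbar\mathbb{Z}^n)$. In particular, if $u_0,u_1\in\ell^2(\hbar\mathbb{Z}^n)$ and $f\in L^2([0,T];\ell^2(\hbar\mathbb{Z}^n))$, then for every $t\in[0,T]$ we have $u(t),\partial_tu(t)\in\ell^2(\hbar\mathbb{Z}^n)$. Moreover, for each $\hbar>0$ there exists a constant $C_{\hbar,T}>0$ such that $$\|u(t)\|^2_{\ell^2(\hbar\mathbb{Z}^n)}+\|\partial_tu(t)\|^2_{\ell^2(\hbar\mathbb{Z}^n)}\le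 C_{\hbar,T}\left(\|u_0\|^2_{\ell^2(\hbar\mathbb{Z}^n)}+\|u_1\|^2_{\ell^2(\hbar\mathbb{Z}^n)}+\|f\|^2_{L^2([0,T];\ell^2(\hbar\mathbb{Z}^n))}\right)$$ for all $t\in[0,T]$, all $u_0,u_1\in\ell^2(\hbar\mathbb{Z}^n)$ and all $f\in L^2([0,T];\ell^2(\hbar\mathbb{Z}^n))$.
   Context: For $\hbar>0$, $\hbar\mathbb{Z}^n=\{x\in\mathbb{R}^n: x=\hbar k,\ k\in\mathbb{Z}^n\}$. The space $\ell^2(\hbar\mathbb{Z}^n)$ consists of the functions $u:\hbar\mathbb{Z}^n\to\mathbb{C}$ with $\|u\|^2_{\ell^2(\hbar\mathbb{Z}^n)}=\sum_{k\in\hbar\mathbb{Z}^n}|u(k)|^2<\infty$. The discrete Laplacian is $$\mathcal{L}_\hbar u(k)=\sum_{j=1}^n\left(u(k+\hbar v_j)+u(k-\hbar v_j)\right)-2n\,u(k),$$ where $v_j$ is the $j$-th standard basis vector of $\mathbb{Z}^n$. We write $u(t)=u(t,\cdot)$. Well-posedness in $\ell^2(\hbar\mathbb{Z}^n)$ means that for all data $u_0,u_1\in\ell^2(\hbar\mathbb{Z}^n)$ and $f\in L^2([0,T];\ell^2(\hbar\mathbb{Z}^n))$ there is a unique solution $u$ with $u(t),\partial_tu(t)\in\ell^2(\hbar\mathbb{Z}^n)$ for every $t\in[0,T]$, depending continuously on the data. Since $b$ and $f$ are only measurable in $t$, the equation is understood for almost every $t$, with $u$ and $\partial_tu$ absolutely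 continuous in $t$. $\mathrm{Lip}([0,T])$ is the space of Lipschitz functions on $[0,T]$. For $0<\alpha\le 1$, $a\in\mathcal{C}^\alpha([0,T])$ means that there is a constant $L_a$ with $|a(t)-a(s)|\le L_a|t-s|^\alpha$ for all $t,s\in[0,T]$. For $1<\alpha<2$, $a\in\mathcal{C}^\alpha([0,T])$ means that $a$ is continuously differentiable and $a'$ is Hölder continuous of order $\alpha-1$. $\mathcal{C}^l([0,T])$, $l\ge 2$, is the usual space of $l$ times continuously differentiable functions. *)

theory Defs
  imports "HOL-Analysis.Analysis"
begin

definition lattice_hZ :: "real \<Rightarrow> (real ^ 'n) set" where
  "lattice_hZ h = {x. \<exists>k :: int ^ 'n. x = h *\<^sub>R (\<chi> j. of_int (k $ j))}"

(* A function on the lattice is represented by a function on the whole of real ^ 'n; every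
   notion below only looks at its values at lattice points. *)

definition ell2 :: "real \<Rightarrow> (real ^ 'n \<Rightarrow> complex) set" where
  "ell2 h = {u. (\<lambda>k. (cmod (u k))\<^sup>2) summable_on lattice_hZ h}"

definition ell2_norm :: "real \<Rightarrow> (real ^ 'n \<Rightarrow> complex) \<Rightarrow> real" where
  "ell2_norm h u = sqrt (\<Sum>\<^sub>\<infinity>k\<in>lattice_hZ h. (cmod (u k))\<^sup>2)"

definition discrete_laplacian ::
    "real \<Rightarrow> (real ^ 'n \<Rightarrow> complex) \<Rightarrow> real ^ 'n \<Rightarrow> complex" where
  "discrete_laplacian h u k =
     (\<Sum>j\<in>UNIV. u (k + h *\<^sub>R axis j 1) + u (k - h *\<^sub>R axis j 1))
       - 2 * of_nat CARD('n) * u k"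

text \<open>Bochner (strong) measurability on [0,T] for the norm of the sequence space: almost
  everywhere limit, in norm, of simple functions.\<close>

definition ell2_strongly_measurable ::
    "real \<Rightarrow> real \<Rightarrow> (real \<Rightarrow> real ^ 'n \<Rightarrow> complex) \<Rightarrow> bool" where
  "ell2_strongly_measurable h T f \<longleftrightarrow>
     (\<exists>s :: nat \<Rightarrow> real \<Rightarrow> real ^ 'n \<Rightarrow> complex.
        (\<forall>i. simple_function (lebesgue_on {0..T}) (s i) \<and> (\<forall>t\<in>{0..T}. s i t \<in> ell2 h)) \<and>
        (AE t in lebesgue_on {0..T}. (\<lambda>i. ell2_norm h (\<lambda>k. s i t k - f t k)) \<longlonglongrightarrow> 0))"

definition L2_ell2 :: "real \<Rightarrow> real \<Rightarrow> (real \<Rightarrow> real ^ 'n \<Rightarrow> complex) set" where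
  "L2_ell2 h T = {f. (\<forall>t\<in>{0..T}. f t \<in> ell2 h) \<and> ell2_strongly_measurable h T f \<and>
     integrable (lebesgue_on {0..T}) (\<lambda>t. (ell2_norm h (f t))\<^sup>2)}"

definition L2_ell2_norm :: "real \<Rightarrow> real \<Rightarrow> (real \<Rightarrow> real ^ 'n \<Rightarrow> complex) \<Rightarrow> real" where
  "L2_ell2_norm h T f = sqrt (LINT t|lebesgue_on {0..T}. (ell2_norm h (f t))\<^sup>2)"

definition ell2_absolutely_continuous ::
    "real \<Rightarrow> real \<Rightarrow> (real \<Rightarrow> real ^ 'n \<Rightarrow> complex) \<Rightarrow> bool" where
  "ell2_absolutely_continuous h T g \<longleftrightarrow>
     (\<forall>\<epsilon>>0. \<exists>\<delta>>0. \<forall>(N::nat) (c::nat \<Rightarrow> real) (d::nat \<Rightarrow> real).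
        (\<forall>i<N. 0 \<le> c i \<and> c i \<le> d i \<and> d i \<le> T) \<and>
        disjoint_family_on (\<lambda>i. {c i<..<d i}) {..<N} \<and>
        (\<Sum>i<N. d i - c i) < \<delta> \<longrightarrow>
        (\<Sum>i<N. ell2_norm h (\<lambda>k. g (d i) k - g (c i) k)) < \<epsilon>)"

definition ddt :: "real \<Rightarrow> (real \<Rightarrow> real ^ 'n \<Rightarrow> complex) \<Rightarrow> real \<Rightarrow> real ^ 'n \<Rightarrow> complex" where
  "ddt T u t k = vector_derivative (\<lambda>s. u s k) (at t within {0..T})"

definition ell2_solution ::
    "real \<Rightarrow> real \<Rightarrow> (real \<Rightarrow> real) \<Rightarrow> (real \<Rightarrow> real) \<Rightarrow>
     (real ^ 'n \<Rightarrow> complex) \<Rightarrow> (real ^ 'n \<Rightarrow> complex) \<Rightarrow> (real \<Rightarrow> real ^ 'n \<Rightarrow> complex) \<Rightarrow>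
     (real \<Rightarrow> real ^ 'n \<Rightarrow> complex) \<Rightarrow> bool" where
  "ell2_solution h T a b u0 u1 f u \<longleftrightarrow>
     (\<forall>t\<in>{0..T}. \<forall>k\<in>lattice_hZ h. (\<lambda>s. u s k) differentiable (at t within {0..T})) \<and>
     (\<forall>t\<in>{0..T}. u t \<in> ell2 h \<and> ddt T u t \<in> ell2 h) \<and>
     ell2_absolutely_continuous h T u \<and>
     ell2_absolutely_continuous h T (ddt T u) \<and>
     (AE t in lebesgue_on {0..T}. \<forall>k\<in>lattice_hZ h.
        (\<lambda>s. ddt T u s k) differentiable (at t within {0..T}) \<and>
        ddt T (ddt T u) t k - of_real (a t / h\<^sup>2) * discrete_laplacian h (u t) k
          + of_real (b t) * u t k = f t k) \<and>
     (\<forall>k\<in>lattice_hZ h. u 0 k = u0 k) \<and>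
     (\<forall>k\<in>lattice_hZ h. ddt T u 0 k = u1 k)"

text \<open>Existence, uniqueness and continuity of the map sending the data to the solution and its
  time derivative, uniformly on [0,T].\<close>

definition ell2_well_posed ::
    "'n::finite itself \<Rightarrow> real \<Rightarrow> real \<Rightarrow> (real \<Rightarrow> real) \<Rightarrow> (real \<Rightarrow> real) \<Rightarrow> bool" where
  "ell2_well_posed _ h T a b \<longleftrightarrow>
     (\<forall>(u0 :: real ^ 'n \<Rightarrow> complex) u1 f.
        u0 \<in> ell2 h \<longrightarrow> u1 \<in> ell2 h \<longrightarrow> f \<in> L2_ell2 h T \<longrightarrow>
        (\<exists>u. ell2_solution h T a b u0 u1 f u)) \<and>
     (\<forall>(u0 :: real ^ 'n \<Rightarrow> complex) u1 f u w.
        u0 \<in> ell2 h \<longrightarrow> u1 \<in> ell2 h \<longrightarrow> f \<in> L2_ell2 h T \<longrightarrow>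
        ell2_solution h T a b u0 u1 f u \<longrightarrow> ell2_solution h T a b u0 u1 f w \<longrightarrow>
        (\<forall>t\<in>{0..T}. \<forall>k\<in>lattice_hZ h. u t k = w t k)) \<and>
     (\<forall>(u0 :: real ^ 'n \<Rightarrow> complex) u1 f u.
        u0 \<in> ell2 h \<longrightarrow> u1 \<in> ell2 h \<longrightarrow> f \<in> L2_ell2 h T \<longrightarrow>
        ell2_solution h T a b u0 u1 f u \<longrightarrow>
        (\<forall>\<epsilon>>0. \<exists>\<delta>>0. \<forall>w0 w1 g w.
           w0 \<in> ell2 h \<longrightarrow> w1 \<in> ell2 h \<longrightarrow> g \<in> L2_ell2 h T \<longrightarrow>
           ell2_solution h T a b w0 w1 g w \<longrightarrow>
           ell2_norm h (\<lambda>k. w0 k - u0 k) + ell2_norm h (\<lambda>k. w1 k - u1 k)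
             + L2_ell2_norm h T (\<lambda>t k. g t k - f t k) < \<delta> \<longrightarrow>
           (\<forall>t\<in>{0..T}. ell2_norm h (\<lambda>k. w t k - u t k)
              + ell2_norm h (\<lambda>k. ddt T w t k - ddt T u t k) < \<epsilon>)))"

definition L_infinity :: "real \<Rightarrow> (real \<Rightarrow> real) \<Rightarrow> bool" where
  "L_infinity T b \<longleftrightarrow> b \<in> borel_measurable (lebesgue_on {0..T}) \<and>
     (\<exists>M. AE t in lebesgue_on {0..T}. \<bar>b t\<bar> \<le> M)"

definition Lip_class :: "real \<Rightarrow> (real \<Rightarrow> real) \<Rightarrow> bool" where
  "Lip_class T a \<longleftrightarrow> (\<exists>L. L-lipschitz_on {0..T} a)"

definition hoelder_cond :: "real \<Rightarrow> real \<Rightarrow> (real \<Rightarrow> real) \<Rightarrow> bool" where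
  "hoelder_cond \<alpha> T a \<longleftrightarrow> (\<exists>L. \<forall>t\<in>{0..T}. \<forall>s\<in>{0..T}. \<bar>a t - a s\<bar> \<le> L * \<bar>t - s\<bar> powr \<alpha>)"

text \<open>Intended for orders strictly between 0 and 2; order 1 means Lipschitz.\<close>

definition hoelder_class :: "real \<Rightarrow> real \<Rightarrow> (real \<Rightarrow> real) \<Rightarrow> bool" where
  "hoelder_class \<alpha> T a \<longleftrightarrow>
     (if \<alpha> \<le> 1 then hoelder_cond \<alpha> T a
      else (\<exists>a'. (\<forall>t\<in>{0..T}. (a has_real_derivative a' t) (at t within {0..T})) \<and>
                 continuous_on {0..T} a' \<and> hoelder_cond (\<alpha> - 1) T a'))"

text \<open>The sequence \<open>d\<close> lists the derivatives of \<open>a\<close>, one-sided at the endpoints.\<close>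

definition C_class :: "nat \<Rightarrow> real \<Rightarrow> (real \<Rightarrow> real) \<Rightarrow> bool" where
  "C_class l T a \<longleftrightarrow>
     (\<exists>d :: nat \<Rightarrow> real \<Rightarrow> real.
        (\<forall>t\<in>{0..T}. d 0 t = a t) \<and>
        (\<forall>i<l. \<forall>t\<in>{0..T}. (d i has_real_derivative d (Suc i) t) (at t within {0..T})) \<and>
        continuous_on {0..T} (d l))"

definition positive_minimum :: "real \<Rightarrow> (real \<Rightarrow> real) \<Rightarrow> bool" where
  "positive_minimum T a \<longleftrightarrow> (\<exists>t0\<in>{0..T}. (\<forall>t\<in>{0..T}. a t0 \<le> a t) \<and> 0 < a t0)"

end

theory Submission
  imports Defs
begin

text \<open>
  For fixed \<open>h\<close> the lattice Laplacian is a bounded operator on \<open>ell2 h\<close>: it is a finite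
  combination of translations (\<open>discrete_laplacian_bounded\<close>). In each of the four cases \<open>a\<close> is
  continuous, hence bounded on \<open>{0..T}\<close>, and \<open>b\<close> is essentially bounded. The problem is
  therefore a linear equation \<open>u'' = G(t) u + f\<close> in a Hilbert space with
  \<open>\<parallel>G(t) x\<parallel> \<le> M \<parallel>x\<parallel>\<close>, where \<open>M\<close> grows like \<open>1 / h\<^sup>2\<close>; this growth is why the constant of
  the estimate depends on \<open>h\<close>. The locale \<open>bounded_generator\<close> treats that equation, and
  \<open>bounded_generator_wave\<close> shows that the lattice problem is an instance.

  The a priori bound is \<open>energy_estimate\<close>: by Minkowski's inequality the energy
  \<open>\<parallel>u\<parallel> + \<parallel>u'\<parallel>\<close> is at most the size of the data plus \<open>1 + M\<close> times its own integral, and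
  Gronwall's inequality gives a bound by \<open>exp ((1 + M) T)\<close> times the data. Applied to the
  difference of two solutions, it yields uniqueness and continuous dependence; squared, it yields the
  stated inequality. Existence is \<open>solution_exists\<close>: twice integrated, the equation is a Volterra
  equation whose integral operator at least halves the norm weighted by \<open>exp (- (1 + 2 M) t)\<close>, so Picard
  iteration converges.

  Since \<open>b\<close> and \<open>f\<close> are only measurable in time, passing between the differential and the
  integrated equation takes two facts about absolutely continuous functions: they are the integral
  of their almost everywhere derivative
  (\<open>has_integral_ae_derivative_of_absolutely_continuous\<close>), needed for the energy estimate, and
  an indefinite integral is differentiable almost everywhere with the integrand as derivative
  (\<open>indefinite_integral_has_vector_derivative_ae\<close>), needed for existence. Integrals of functions
  with values in \<open>ell2 h\<close> are taken lattice point by lattice point. Norms are recovered from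
  \<open>ell2_norm_integral_le\<close>.
\<close>

section \<open>Absolutely continuous functions of one real variable\<close>

text \<open>Lebesgue differentiation on an interval. The averages \<open>integrable_ccontinuous_explicit\<close>
  of the multivariate theory run over boxes with lower corner \<open>x\<close>, so in dimension one they
  control the right difference quotients; applied to the reflection \<open>\<lambda>x. f (- x)\<close> they control the
  left ones.\<close>

lemma indefinite_integral_has_vector_derivative_ae:
  fixes f :: "real \<Rightarrow> 'a::euclidean_space"
  assumes f: "f integrable_on {a..b}"
  obtains N where "negligible N"
    "\<And>x. x \<in> {a..b} - N \<Longrightarrow>
       ((\<lambda>x. integral {a..x} f) has_vector_derivative f x) (at x within {a..b})"
proof -
  \<comment> \<open>The averages need a function that is integrable on every interval.\<close>
  define g where "g x = (if x \<in> {a..b} then f x else 0)" for x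
  have g: "g integrable_on cbox c d" for c d
  proof -
    have "g integrable_on UNIV"
      using f integrable_restrict_UNIV[of "{a..b}" f] by (simp add: g_def[abs_def])
    then show ?thesis
      using integrable_on_subcbox by blast
  qed
  have gm: "(\<lambda>x. g (- x)) integrable_on cbox c d" for c d
    using g[of "-d" "-c"] Henstock_Kurzweil_Integration.integrable_reflect_real[where f=g and a="-d" and b="-c"] by (simp only: minus_minus box_real)
  obtain N1 where N1: "negligible N1"
    "\<And>x e. x \<notin> N1 \<Longrightarrow> 0 < e \<Longrightarrow> \<exists>d>0. \<forall>h. 0 < h \<and> h < d \<longrightarrow>
        norm (integral (cbox x (x + h *\<^sub>R One)) g /\<^sub>R h ^ DIM(real) - g x) < e"
    using integrable_ccontinuous_explicit[OF g] by blast
  obtain N2 where N2: "negligible N2"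
    "\<And>x e. x \<notin> N2 \<Longrightarrow> 0 < e \<Longrightarrow> \<exists>d>0. \<forall>h. 0 < h \<and> h < d \<longrightarrow>
        norm (integral (cbox x (x + h *\<^sub>R One)) (\<lambda>x. g (- x)) /\<^sub>R h ^ DIM(real) - g (- x)) < e"
    using integrable_ccontinuous_explicit[OF gm] by blast
  have eq: "integral {c..d} g = integral {c..d} f" if "a \<le> c" "d \<le> b" for c d
    by (rule integral_cong) (use that in \<open>auto simp: g_def\<close>)
  have scale: "norm (v - h *\<^sub>R w) \<le> e * h" if "0 < h" "norm (v /\<^sub>R h - w) < e" for v w :: 'a and h e
  proof -
    have "v - h *\<^sub>R w = h *\<^sub>R (v /\<^sub>R h - w)"
      using that by (simp add: algebra_simps)
    then have "norm (v - h *\<^sub>R w) = h * norm (v /\<^sub>R h - w)"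
      using that by simp
    also have "\<dots> \<le> h * e"
      using that by (intro mult_left_mono) auto
    finally show ?thesis by (simp add: mult.commute)
  qed
  show thesis
  proof
    show "negligible (N1 \<union> uminus ` N2)"
      by (intro negligible_Un N1(1) negligible_differentiable_image_negligible[OF _ N2(1)]
          differentiable_on_minus differentiable_on_ident) simp
    fix x
    assume x: "x \<in> {a..b} - (N1 \<union> uminus ` N2)"
    then have x1: "x \<notin> N1" and x2: "- x \<notin> N2" and xab: "a \<le> x" "x \<le> b"
      by (auto simp: image_iff)
    show "((\<lambda>x. integral {a..x} f) has_vector_derivative f x) (at x within {a..b})"
      unfolding has_vector_derivative_def has_derivative_within_alt
    proof (intro conjI allI impI)
      fix e :: real assume "e > 0"
      obtain d1 where d1: "d1 > 0" "\<And>h. 0 < h \<Longrightarrow> h < d1 \<Longrightarrow>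
          norm (integral {x..x + h} g /\<^sub>R h - g x) < e"
        using N1(2)[OF x1 \<open>e > 0\<close>] by auto
      obtain d2 where d2: "d2 > 0" "\<And>h. 0 < h \<Longrightarrow> h < d2 \<Longrightarrow>
          norm (integral {- x..- x + h} (\<lambda>x. g (- x)) /\<^sub>R h - g x) < e"
        using N2(2)[OF x2 \<open>e > 0\<close>] by auto
      show "\<exists>d>0. \<forall>y\<in>{a..b}. norm (y - x) < d \<longrightarrow>
          norm (integral {a..y} f - integral {a..x} f - (y - x) *\<^sub>R f x) \<le> e * norm (y - x)"
      proof (intro exI[of _ "min d1 d2"] conjI ballI impI)
        fix y assume y: "y \<in> {a..b}" "norm (y - x) < min d1 d2"
        have int: "f integrable_on {a..z}" if "z \<le> b" for z
          using integrable_subinterval_real[OF f] that by auto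
        consider "y = x" | "y > x" | "y < x" by linarith
        then show "norm (integral {a..y} f - integral {a..x} f - (y - x) *\<^sub>R f x) \<le> e * norm (y - x)"
        proof cases
          case 2
          have "integral {a..x} f + integral {x..y} f = integral {a..y} f"
            by (rule Henstock_Kurzweil_Integration.integral_combine) (use 2 y xab int in auto)
          then have "integral {a..y} f - integral {a..x} f = integral {x..y} f"
            by (simp add: algebra_simps)
          moreover have "norm (integral {x..x + (y - x)} g - (y - x) *\<^sub>R g x) \<le> e * (y - x)"
            by (rule scale) (use 2 y d1(2)[of "y - x"] in auto)
          moreover have "g x = f x" using xab by (simp add: g_def)
          ultimately show ?thesis
            using eq[of x y] xab y 2 by simp
        next
          case 3
          have "integral {a..y} f + integral {y..x} f = integral {a..x} f"
            by (rule Henstock_Kurzweil_Integration.integral_combine) (use 3 y xab int in auto)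
          then have *: "integral {a..y} f - integral {a..x} f = - integral {y..x} f"
            by (simp add: algebra_simps)
          have "norm (integral {- x..- x + (x - y)} (\<lambda>x. g (- x)) - (x - y) *\<^sub>R g x) \<le> e * (x - y)"
            by (rule scale) (use 3 y d2(2)[of "x - y"] in auto)
          moreover have "integral {- x..- x + (x - y)} (\<lambda>x. g (- x)) = integral {y..x} f"
            using integral_reflect_real[of x y g] eq[of y x] xab y by simp
          moreover have "g x = f x" using xab by (simp add: g_def)
          ultimately have "norm (integral {y..x} f - (x - y) *\<^sub>R f x) \<le> e * (x - y)"
            by simp
          moreover have "integral {a..y} f - integral {a..x} f - (y - x) *\<^sub>R f x
              = - (integral {y..x} f - (x - y) *\<^sub>R f x)"
            unfolding * by (simp add: algebra_simps)
          ultimately show ?thesis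
            using 3 by (metis abs_minus_commute abs_of_pos diff_gt_0_iff_gt norm_minus_cancel real_norm_def)
        qed auto
      qed (use d1 d2 in auto)
    qed (auto intro: bounded_linear_scaleR_left)
  qed
qed

text \<open>The variance of \<open>N\<close> on \<open>{a..b}\<close> is nonnegative.\<close>

lemma integral_square_le:
  fixes N :: "real \<Rightarrow> real"
  assumes "a \<le> b" "N integrable_on {a..b}" "(\<lambda>x. (N x)\<^sup>2) integrable_on {a..b}"
  shows "(integral {a..b} N)\<^sup>2 \<le> (b - a) * integral {a..b} (\<lambda>x. (N x)\<^sup>2)"
proof (cases "a = b")
  case False
  define m where "m = integral {a..b} N / (b - a)"
  have eq: "(\<lambda>x. (N x - m)\<^sup>2) = (\<lambda>x. (N x)\<^sup>2 - 2 * m * N x + m\<^sup>2)"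
    by (auto simp: power2_diff algebra_simps)
  have "((\<lambda>x. (N x - m)\<^sup>2) has_integral
      integral {a..b} (\<lambda>x. (N x)\<^sup>2) - 2 * m * integral {a..b} N + (b - a) * m\<^sup>2) {a..b}"
    unfolding eq
    by (intro has_integral_add has_integral_diff has_integral_mult_right integrable_integral assms)
       (use has_integral_const_real[of "m\<^sup>2" a b] assms in auto)
  then have *: "0 \<le> integral {a..b} (\<lambda>x. (N x)\<^sup>2) - 2 * m * integral {a..b} N + (b - a) * m\<^sup>2"
    by (rule has_integral_nonneg) auto
  have "(b - a) * m = integral {a..b} N"
    using False by (simp add: m_def)
  then have "(b - a) * m\<^sup>2 = m * integral {a..b} N"
    by (metis mult.commute mult.left_commute power2_eq_square)
  then have "0 \<le> integral {a..b} (\<lambda>x. (N x)\<^sup>2) - m * integral {a..b} N"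
    using * by linarith
  then have "0 \<le> (b - a) * (integral {a..b} (\<lambda>x. (N x)\<^sup>2) - m * integral {a..b} N)"
    using assms by simp
  moreover have "(b - a) * (m * integral {a..b} N) = (integral {a..b} N)\<^sup>2"
    using \<open>(b - a) * m = integral {a..b} N\<close> by (simp add: power2_eq_square flip: mult.assoc)
  ultimately show ?thesis
    by (simp add: algebra_simps)
qed auto

text \<open>Gronwall: the right-hand side \<open>y\<close> of the hypothesis satisfies \<open>y' = C E \<le> C y\<close>, so that
  \<open>exp (- C t) y t\<close> does not increase.\<close>

lemma gronwall_integral:
  fixes E :: "real \<Rightarrow> real"
  assumes cont: "continuous_on {0..T} E" and "C \<ge> 0"
    and le: "\<And>t. t \<in> {0..T} \<Longrightarrow> E t \<le> D + C * integral {0..t} E"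
    and t: "t \<in> {0..T}"
  shows "E t \<le> D * exp (C * t)"
proof -
  define y where "y t = D + C * integral {0..t} E" for t
  have der: "((\<lambda>t. exp (- C * t) * y t) has_real_derivative
      exp (- C * s) * (C * (E s - y s))) (at s within {0..T})" if "s \<in> {0..T}" for s
  proof -
    have "((\<lambda>t. integral {0..t} E) has_real_derivative E s) (at s within {0..T})"
      using integral_has_real_derivative[OF cont that] .
    then show ?thesis
      unfolding y_def by (auto intro!: derivative_eq_intros simp: algebra_simps)
  qed
  have y_nonpos: "exp (- C * s) * (C * (E s - y s)) \<le> 0" if "s \<in> {0..T}" for s
    using le[OF that] \<open>C \<ge> 0\<close> unfolding y_def
    by (intro mult_nonneg_nonpos) auto
  have "\<exists>s\<in>{0..t}. exp (- C * t) * y t - exp (- C * 0) * y 0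
      = (t - 0) * (exp (- C * s) * (C * (E s - y s)))"
  proof (rule mvt_very_simple)
    fix s assume "0 \<le> s" "s \<le> t"
    then have "((\<lambda>t. exp (- C * t) * y t) has_derivative
        (\<lambda>h. exp (- C * s) * (C * (E s - y s)) * h)) (at s within {0..t})"
      using t by (intro has_derivative_subset[OF der[unfolded has_field_derivative_def]]) auto
    then show "((\<lambda>t. exp (- C * t) * y t) has_derivative
        (\<lambda>h. h * (exp (- C * s) * (C * (E s - y s))))) (at s within {0..t})"
      by (simp only: mult.commute[of _ "exp (- C * s) * (C * (E s - y s))"])
  qed (use t in auto)
  then have "exp (- C * t) * y t \<le> exp (- C * 0) * y 0"
    using mult_nonneg_nonpos[OF _ y_nonpos, of t] t by fastforce
  then have "y t \<le> D * exp (C * t)"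
    by (simp add: y_def exp_minus field_simps)
  then show ?thesis
    using le[OF t] by (simp add: y_def)
qed

text \<open>The fundamental theorem of calculus when the derivative is known only outside a null set \<open>N\<close>.
  A gauge on \<open>{a..b}\<close> is made of two parts. At a tag outside \<open>N\<close> it is so small that the
  increment of \<open>g\<close> is its derivative times the length, up to a small multiple of the length. At a
  tag in \<open>N\<close> it is an open set \<open>U \<supseteq> N\<close> of small measure: the intervals with these tags have
  disjoint interiors and lie in \<open>U\<close>, so absolute continuity bounds the sum of the increments of \<open>g\<close>
  over them.\<close>

lemma has_integral_ae_derivative_of_absolutely_continuous:
  fixes g g' :: "real \<Rightarrow> 'a::banach"
  assumes "a \<le> b" and N: "negligible N"
    and der: "\<And>x. x \<in> {a..b} - N \<Longrightarrow> (g has_vector_derivative g' x) (at x within {a..b})"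
    and ac: "\<And>\<epsilon>. \<epsilon> > 0 \<Longrightarrow> \<exists>\<delta>>0. \<forall>(n::nat) c d.
        (\<forall>i<n. a \<le> c i \<and> c i \<le> d i \<and> d i \<le> b) \<and>
        disjoint_family_on (\<lambda>i. {c i<..<d i}) {..<n} \<and> (\<Sum>i<n. d i - c i) < \<delta> \<longrightarrow>
        (\<Sum>i<n. norm (g (d i) - g (c i))) < \<epsilon>"
  shows "(g' has_integral g b - g a) {a..b}"
proof -
  define F where "F x = (if x \<in> N then 0 else g' x)" for x
  have "(F has_integral g b - g a) (cbox a b)"
    unfolding has_integral
  proof (intro allI impI)
    fix e :: real assume "e > 0"
    \<comment> \<open>The summand 1 keeps the denominator positive when the interval is a point.\<close>
    define \<eta> where "\<eta> = e / (2 * (b - a + 1))"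
    have "\<eta> > 0" and \<eta>: "\<eta> * (b - a) < e / 2"
      using \<open>e > 0\<close> \<open>a \<le> b\<close> by (auto simp: \<eta>_def field_simps)
    obtain \<delta> where "\<delta> > 0" and \<delta>: "\<forall>(n::nat) c d. (\<forall>i<n. a \<le> c i \<and> c i \<le> d i \<and> d i \<le> b) \<and>
        disjoint_family_on (\<lambda>i. {c i<..<d i}) {..<n} \<and> (\<Sum>i<n. d i - c i) < \<delta> \<longrightarrow>
        (\<Sum>i<n. norm (g (d i) - g (c i))) < e / 2"
      using ac[OF half_gt_zero[OF \<open>e > 0\<close>]] by (elim exE conjE)
    obtain U where U: "open U" "N \<subseteq> U" "(U - N) \<in> lmeasurable" "emeasure lebesgue (U - N) < ennreal \<delta>"
      using sets_lebesgue_outer_open[of N \<delta>] N \<open>\<delta> > 0\<close> negligible_imp_sets by blast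
    have Um: "U \<in> lmeasurable" "measure lebesgue U < \<delta>"
    proof -
      have "U = (U - N) \<union> N" using U by auto
      then show "U \<in> lmeasurable"
        using U(3) negligible_imp_measurable[OF N] fmeasurable.Un by metis
      have "measure lebesgue U \<le> measure lebesgue (U - N) + measure lebesgue N"
        using measure_Un_le[of "U - N" lebesgue N] \<open>U = (U - N) \<union> N\<close> U(3) negligible_imp_sets[OF N]
        by (simp add: fmeasurableD)
      also have "\<dots> = measure lebesgue (U - N)"
        using negligible_imp_measure0[OF N] by simp
      also have "\<dots> < \<delta>"
        using U(4) \<open>\<delta> > 0\<close> emeasure_eq_measure2[OF U(3)] by (simp add: ennreal_less_iff)
      finally show "measure lebesgue U < \<delta>" .
    qed
    have "\<exists>d>0. x \<in> {a..b} - N \<longrightarrow> (\<forall>y\<in>{a..b}. norm (y - x) < d \<longrightarrow>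
        norm (g y - g x - (y - x) *\<^sub>R g' x) \<le> \<eta> * norm (y - x))" for x
      using der[of x] \<open>\<eta> > 0\<close> unfolding has_vector_derivative_def has_derivative_within_alt
      by (cases "x \<in> {a..b} - N") (auto intro: exI[of _ 1])
    then obtain r where r: "\<And>x. r x > 0" "\<And>x y. x \<in> {a..b} - N \<Longrightarrow> y \<in> {a..b} \<Longrightarrow>
        norm (y - x) < r x \<Longrightarrow> norm (g y - g x - (y - x) *\<^sub>R g' x) \<le> \<eta> * norm (y - x)"
      by metis
    define \<gamma> where "\<gamma> x = (if x \<in> N then U else ball x (r x))" for x
    have "gauge \<gamma>"
      using U r(1) by (auto simp: gauge_def \<gamma>_def)
    moreover have "norm ((\<Sum>(x,K)\<in>p. measure lborel K *\<^sub>R F x) - (g b - g a)) < e"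
      if p: "p tagged_division_of cbox a b" and fine: "\<gamma> fine p" for p
    proof -
      have "finite p" using p by auto
      have pab: "p tagged_division_of {a..b}" using p by simp
      have K: "\<exists>u v. K = {u..v} \<and> u \<le> v \<and> x \<in> K \<and> a \<le> u \<and> v \<le> b \<and> K \<subseteq> \<gamma> x \<and> Inf K = u \<and> Sup K = v \<and>
          measure lborel K = v - u" if "(x, K) \<in> p" for x K
      proof -
        obtain u v where uv: "K = cbox u v" using p \<open>(x, K) \<in> p\<close> by blast
        moreover have "x \<in> K" "K \<subseteq> cbox a b" using p \<open>(x, K) \<in> p\<close> by blast+
        moreover have "K \<subseteq> \<gamma> x" using fine \<open>(x, K) \<in> p\<close> by (auto simp: fine_def)
        ultimately show ?thesis by (intro exI[of _ u] exI[of _ v]) auto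
      qed
      \<comment> \<open>the part of the division whose tags lie in the exceptional set\<close>
      define q where "q = {xK \<in> p. fst xK \<in> N}"
      have q: "finite q" "q \<subseteq> p" using \<open>finite p\<close> by (auto simp: q_def)
      define D where "D = (\<lambda>(x,K). measure lborel K *\<^sub>R F x - (g (Sup K) - g (Inf K)))"
      have "(\<Sum>(x,K)\<in>p. measure lborel K *\<^sub>R F x) - (g b - g a) = sum D p"
        unfolding D_def additive_tagged_division_1[OF \<open>a \<le> b\<close> pab, of g, symmetric]
        by (simp add: sum_subtractf case_prod_unfold)
      then have "norm ((\<Sum>(x,K)\<in>p. measure lborel K *\<^sub>R F x) - (g b - g a)) \<le> (\<Sum>xK\<in>p. norm (D xK))"
        by (simp only: norm_sum)
      also have "(\<Sum>xK\<in>p. norm (D xK)) = (\<Sum>xK\<in>p - q. norm (D xK)) + (\<Sum>xK\<in>q. norm (D xK))"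
        by (rule sum.subset_diff) (use q \<open>finite p\<close> in auto)
      finally have split: "norm ((\<Sum>(x,K)\<in>p. measure lborel K *\<^sub>R F x) - (g b - g a))
          \<le> (\<Sum>xK\<in>p - q. norm (D xK)) + (\<Sum>xK\<in>q. norm (D xK))" .
      have regular: "(\<Sum>xK\<in>p - q. norm (D xK)) \<le> \<eta> * (b - a)"
      proof -
        have "norm (D (x,K)) \<le> \<eta> * (Sup K - Inf K)" if xK: "(x, K) \<in> p - q" for x K
        proof -
          obtain u v where uv: "K = {u..v}" "u \<le> v" "x \<in> K" "a \<le> u" "v \<le> b" "K \<subseteq> \<gamma> x"
            "Inf K = u" "Sup K = v" "measure lborel K = v - u" using K[of x K] xK by blast
          have xN: "x \<in> {a..b} - N" using xK uv by (auto simp: q_def)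
          have "u \<in> K" "v \<in> K" using uv by auto
          then have ruv: "norm (u - x) < r x" "norm (v - x) < r x"
            using uv(6) xN by (auto simp: \<gamma>_def dist_real_def subset_iff split: if_splits)
          have "D (x,K) = (g u - g x - (u - x) *\<^sub>R g' x) - (g v - g x - (v - x) *\<^sub>R g' x)"
            using xN uv by (simp add: D_def F_def algebra_simps)
          also have "norm \<dots> \<le> \<eta> * norm (u - x) + \<eta> * norm (v - x)"
            by (intro order.trans[OF norm_triangle_ineq4] add_mono r(2)[OF xN] ruv) (use uv in auto)
          also have "\<dots> = \<eta> * (Sup K - Inf K)"
            using uv by (auto simp: algebra_simps)
          finally show ?thesis .
        qed
        then have "(\<Sum>xK\<in>p - q. norm (D xK)) \<le> (\<Sum>(x,K)\<in>p - q. \<eta> * (Sup K - Inf K))"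
          by (intro sum_mono) auto
        also have "\<dots> \<le> (\<Sum>(x,K)\<in>p. \<eta> * (Sup K - Inf K))"
          using \<open>finite p\<close> \<open>\<eta> > 0\<close> K by (intro sum_mono2) force+
        also have "\<dots> = \<eta> * (b - a)"
          using additive_tagged_division_1[OF \<open>a \<le> b\<close> pab, of "\<lambda>x. x"]
          by (simp add: case_prod_unfold flip: sum_distrib_left)
        finally show ?thesis .
      qed
      have exceptional: "(\<Sum>xK\<in>q. norm (D xK)) < e / 2"
      proof -
        obtain \<phi> where \<phi>: "bij_betw \<phi> {..<card q} q"
          using ex_bij_betw_nat_finite[OF \<open>finite q\<close>] by (auto simp: atLeast0LessThan)
        define c where "c i = Inf (snd (\<phi> i))" for i
        define d where "d i = Sup (snd (\<phi> i))" for i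
        have \<phi>q: "\<phi> i \<in> q" if "i < card q" for i
          using \<phi> that by (auto simp: bij_betw_def)
        have \<phi>p: "(fst (\<phi> i), snd (\<phi> i)) \<in> p" if "i < card q" for i
          using \<phi>q[OF that] q by auto
        have 1: "\<forall>i<card q. a \<le> c i \<and> c i \<le> d i \<and> d i \<le> b"
        proof (intro allI impI)
          fix i assume "i < card q"
          from K[OF \<phi>p[OF this]] show "a \<le> c i \<and> c i \<le> d i \<and> d i \<le> b"
            unfolding c_def d_def by auto
        qed
        have int: "interior (snd (\<phi> i)) = {c i<..<d i}" if "i < card q" for i
          using K[OF \<phi>p[OF that]] unfolding c_def d_def by (metis interior_atLeastAtMost_real)
        have 2: "disjoint_family_on (\<lambda>i. {c i<..<d i}) {..<card q}"
          unfolding disjoint_family_on_def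
        proof (intro ballI impI)
          fix i j assume ij: "i \<in> {..<card q}" "j \<in> {..<card q}" "i \<noteq> j"
          then have "\<phi> i \<noteq> \<phi> j" using \<phi> by (auto simp: bij_betw_def inj_on_def)
          then have "interior (snd (\<phi> i)) \<inter> interior (snd (\<phi> j)) = {}"
            using tagged_division_ofD(5)[OF p \<phi>p[of i] \<phi>p[of j]] ij by (simp add: prod_eq_iff)
          then show "{c i<..<d i} \<inter> {c j<..<d j} = {}"
            using int ij by simp
        qed
        have 3: "(\<Sum>i<card q. d i - c i) < \<delta>"
        proof -
          have "(\<Sum>i<card q. d i - c i) = (\<Sum>i<card q. measure lebesgue {c i<..<d i})"
            using 1 by (intro sum.cong) auto
          also have "\<dots> = measure lebesgue (\<Union>i<card q. {c i<..<d i})"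
            by (rule measure_negligible_finite_Union_image[symmetric])
               (use 2 in \<open>auto simp: pairwise_def disjoint_family_on_def\<close>)
          also have "\<dots> \<le> measure lebesgue U"
          proof (rule measure_mono_fmeasurable)
            show "(\<Union>i<card q. {c i<..<d i}) \<subseteq> U"
            proof (rule UN_least)
              fix i assume i: "i \<in> {..<card q}"
              then have "snd (\<phi> i) \<subseteq> U"
                using K[OF \<phi>p[of i]] \<phi>q[of i] by (auto simp: q_def \<gamma>_def)
              then show "{c i<..<d i} \<subseteq> U"
                using int[of i] i interior_subset by blast
            qed
          qed (use Um in auto)
          finally show ?thesis using Um by simp
        qed
        have "(\<Sum>xK\<in>q. norm (D xK)) = (\<Sum>i<card q. norm (D (\<phi> i)))"
          by (rule sum.reindex_bij_betw[OF \<phi>, symmetric])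
        also have "\<dots> = (\<Sum>i<card q. norm (g (d i) - g (c i)))"
        proof (intro sum.cong refl)
          fix i assume "i \<in> {..<card q}"
          then have "fst (\<phi> i) \<in> N" using \<phi>q[of i] by (auto simp: q_def)
          then show "norm (D (\<phi> i)) = norm (g (d i) - g (c i))"
            by (simp add: D_def F_def c_def d_def case_prod_unfold norm_minus_commute)
        qed
        also have "\<dots> < e / 2" using \<delta> 1 2 3 by blast
        finally show ?thesis .
      qed
      show ?thesis using \<eta> split regular exceptional by linarith
    qed
    ultimately show "\<exists>\<gamma>. gauge \<gamma> \<and> (\<forall>\<D>. \<D> tagged_division_of cbox a b \<and> \<gamma> fine \<D> \<longrightarrow>
        norm ((\<Sum>(x,K)\<in>\<D>. measure lborel K *\<^sub>R F x) - (g b - g a)) < e)"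
      by (intro exI[of _ \<gamma>]) simp
  qed
  then have "(F has_integral g b - g a) {a..b}" by simp
  then show ?thesis
    by (rule has_integral_spike[OF N, rotated]) (auto simp: F_def)
qed

section \<open>Calculus in the sequence space\<close>

lemma countable_lattice_hZ: "countable (lattice_hZ h :: (real ^ 'n) set)"
proof -
  have "lattice_hZ h = range (\<lambda>k :: int ^ 'n. h *\<^sub>R (\<chi> j. of_int (k $ j)))"
    by (auto simp: lattice_hZ_def)
  then show ?thesis by simp
qed

lemma lattice_hZ_shift:
  assumes "k \<in> lattice_hZ h"
  shows "k + h *\<^sub>R axis j 1 \<in> lattice_hZ h" "k - h *\<^sub>R axis j 1 \<in> lattice_hZ h"
proof -
  obtain i where i: "k = h *\<^sub>R (\<chi> j. of_int (i $ j))"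
    using assms by (auto simp: lattice_hZ_def)
  have "k + h *\<^sub>R axis j 1 = h *\<^sub>R (\<chi> l. of_int ((i + axis j 1) $ l))"
    "k - h *\<^sub>R axis j 1 = h *\<^sub>R (\<chi> l. of_int ((i - axis j 1) $ l))"
    by (auto simp: i vec_eq_iff axis_def algebra_simps)
  then show "k + h *\<^sub>R axis j 1 \<in> lattice_hZ h" "k - h *\<^sub>R axis j 1 \<in> lattice_hZ h"
    unfolding lattice_hZ_def by blast+
qed

text \<open>Norms in \<open>ell2 h\<close> are handled through finite subsets of the lattice, where they are the
  library's \<open>L2_set\<close>; the lemmas \<open>ell2_normI\<close> and \<open>L2_set_le_ell2_norm\<close> pass
  between the two. An operation is shown to preserve \<open>ell2 h\<close> together with its norm bound,
  because both follow from the same bound on finite subsets.\<close>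

lemma ell2_normI:
  assumes "B \<ge> 0"
    and B: "\<And>K. finite K \<Longrightarrow> K \<subseteq> lattice_hZ h \<Longrightarrow> L2_set (\<lambda>k. cmod (u k)) K \<le> B"
  shows "u \<in> ell2 h" "ell2_norm h u \<le> B"
proof -
  have *: "(\<Sum>k\<in>K. (cmod (u k))\<^sup>2) \<le> B\<^sup>2" if "finite K" "K \<subseteq> lattice_hZ h" for K
    using B[OF that] by (simp add: L2_set_def real_sqrt_le_iff' sqrt_le_D)
  then show "u \<in> ell2 h"
    unfolding ell2_def
    by (auto intro!: nonneg_bdd_above_summable_on bdd_aboveI[of _ "B\<^sup>2"])
  then have "(\<Sum>\<^sub>\<infinity>k\<in>lattice_hZ h. (cmod (u k))\<^sup>2) \<le> B\<^sup>2"
    using * by (intro infsum_le_finite_sums) (auto simp: ell2_def)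
  then show "ell2_norm h u \<le> B"
    unfolding ell2_norm_def using \<open>B \<ge> 0\<close> by (simp add: real_le_lsqrt)
qed

lemma L2_set_le_ell2_norm:
  assumes "u \<in> ell2 h" "finite K" "K \<subseteq> lattice_hZ h"
  shows "L2_set (\<lambda>k. cmod (u k)) K \<le> ell2_norm h u"
  unfolding L2_set_def ell2_norm_def
  using assms by (intro real_sqrt_le_mono finite_sum_le_infsum) (auto simp: ell2_def)

lemma cmod_le_ell2_norm:
  assumes "u \<in> ell2 h" "k \<in> lattice_hZ h"
  shows "cmod (u k) \<le> ell2_norm h u"
  using L2_set_le_ell2_norm[of u h "{k}"] assms by simp

lemma ell2_norm_nonneg [simp]: "0 \<le> ell2_norm h u"
  by (simp add: ell2_norm_def infsum_nonneg)

lemma ell2_norm_cong: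
  assumes "\<And>k. k \<in> lattice_hZ h \<Longrightarrow> u k = v k"
  shows "ell2_norm h u = ell2_norm h v"
  unfolding ell2_norm_def using assms by (metis (mono_tags, lifting) infsum_cong)

lemma ell2_cong:
  assumes "\<And>k. k \<in> lattice_hZ h \<Longrightarrow> u k = v k"
  shows "u \<in> ell2 h \<longleftrightarrow> v \<in> ell2 h"
  unfolding ell2_def mem_Collect_eq using assms by (intro summable_on_cong) auto

lemma ell2_add:
  assumes "u \<in> ell2 h" "v \<in> ell2 h"
  shows "(\<lambda>k. u k + v k) \<in> ell2 h" "ell2_norm h (\<lambda>k. u k + v k) \<le> ell2_norm h u + ell2_norm h v"
proof -
  have *: "L2_set (\<lambda>k. cmod (u k + v k)) K \<le> ell2_norm h u + ell2_norm h v"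
    if "finite K" "K \<subseteq> lattice_hZ h" for K
  proof -
    have "L2_set (\<lambda>k. cmod (u k + v k)) K \<le> L2_set (\<lambda>k. cmod (u k) + cmod (v k)) K"
      by (intro L2_set_mono norm_triangle_ineq) auto
    also have "\<dots> \<le> L2_set (\<lambda>k. cmod (u k)) K + L2_set (\<lambda>k. cmod (v k)) K"
      by (rule L2_set_triangle_ineq)
    also have "\<dots> \<le> ell2_norm h u + ell2_norm h v"
      using assms that by (intro add_mono L2_set_le_ell2_norm)
    finally show ?thesis .
  qed
  show "(\<lambda>k. u k + v k) \<in> ell2 h" "ell2_norm h (\<lambda>k. u k + v k) \<le> ell2_norm h u + ell2_norm h v"
    by (rule ell2_normI[OF _ *]; simp)+
qed

lemma ell2_mult:
  assumes "u \<in> ell2 h"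
  shows "(\<lambda>k. c * u k) \<in> ell2 h" "ell2_norm h (\<lambda>k. c * u k) \<le> cmod c * ell2_norm h u"
proof -
  have *: "L2_set (\<lambda>k. cmod (c * u k)) K \<le> cmod c * ell2_norm h u"
    if "finite K" "K \<subseteq> lattice_hZ h" for K
    using L2_set_le_ell2_norm[OF assms that]
    by (simp add: norm_mult L2_set_right_distrib[symmetric] mult_left_mono)
  show "(\<lambda>k. c * u k) \<in> ell2 h" "ell2_norm h (\<lambda>k. c * u k) \<le> cmod c * ell2_norm h u"
    by (rule ell2_normI[OF _ *]; simp)+
qed

lemma ell2_diff:
  assumes "u \<in> ell2 h" "v \<in> ell2 h"
  shows "(\<lambda>k. u k - v k) \<in> ell2 h" "ell2_norm h (\<lambda>k. u k - v k) \<le> ell2_norm h u + ell2_norm h v"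
  using ell2_add[OF assms(1) ell2_mult(1)[OF assms(2), of "-1"]] ell2_mult(2)[OF assms(2), of "-1"]
  by auto

lemma ell2_norm_triangle_diff:
  assumes "u \<in> ell2 h" "v \<in> ell2 h"
  shows "\<bar>ell2_norm h u - ell2_norm h v\<bar> \<le> ell2_norm h (\<lambda>k. u k - v k)"
proof -
  have triangle: "ell2_norm h x \<le> ell2_norm h (\<lambda>k. x k - y k) + ell2_norm h y"
    if "x \<in> ell2 h" "y \<in> ell2 h" for x y
    using ell2_add(2)[OF ell2_diff(1)[OF that] that(2)] by simp
  moreover have "ell2_norm h (\<lambda>k. v k - u k) = ell2_norm h (\<lambda>k. u k - v k)"
    unfolding ell2_norm_def by (simp add: norm_minus_commute)
  ultimately show ?thesis
    using triangle[OF assms] triangle[OF assms(2,1)] by linarith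
qed

lemma ell2_zero [simp]: "(\<lambda>k. 0) \<in> ell2 h" "ell2_norm h (\<lambda>k. 0) = 0"
  by (auto simp: ell2_def ell2_norm_def)

lemma ell2_sum:
  assumes "finite J" "\<And>j. j \<in> J \<Longrightarrow> u j \<in> ell2 h"
  shows "(\<lambda>k. \<Sum>j\<in>J. u j k) \<in> ell2 h \<and>
    ell2_norm h (\<lambda>k. \<Sum>j\<in>J. u j k) \<le> (\<Sum>j\<in>J. ell2_norm h (u j))"
  using assms
proof (induction J)
  case (insert j J)
  then show ?case
    using ell2_add[of "u j" h "\<lambda>k. \<Sum>j\<in>J. u j k"] by auto
qed auto

lemma ell2_reindex:
  assumes "u \<in> ell2 h" "inj_on \<phi> (lattice_hZ h)" "\<phi> ` lattice_hZ h \<subseteq> lattice_hZ h"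
  shows "(\<lambda>k. u (\<phi> k)) \<in> ell2 h" "ell2_norm h (\<lambda>k. u (\<phi> k)) \<le> ell2_norm h u"
proof -
  have *: "L2_set (\<lambda>k. cmod (u (\<phi> k))) K \<le> ell2_norm h u"
    if "finite K" "K \<subseteq> lattice_hZ h" for K
  proof -
    have "L2_set (\<lambda>k. cmod (u (\<phi> k))) K = L2_set (\<lambda>k. cmod (u k)) (\<phi> ` K)"
      unfolding L2_set_def using inj_on_subset[OF assms(2) that(2)] by (simp add: sum.reindex)
    also have "\<dots> \<le> ell2_norm h u"
      using assms that by (intro L2_set_le_ell2_norm) auto
    finally show ?thesis .
  qed
  show "(\<lambda>k. u (\<phi> k)) \<in> ell2 h" "ell2_norm h (\<lambda>k. u (\<phi> k)) \<le> ell2_norm h u"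
    by (rule ell2_normI[OF _ *]; simp)+
qed

text \<open>The Laplacian is a sum of \<open>2 n\<close> lattice translations, each an isometry, and of
  \<open>- 2 n\<close> times the identity.\<close>

lemma discrete_laplacian_bounded:
  fixes u :: "real ^ 'n \<Rightarrow> complex"
  assumes u: "u \<in> ell2 h"
  shows "discrete_laplacian h u \<in> ell2 h"
    "ell2_norm h (discrete_laplacian h u) \<le> 4 * real CARD('n) * ell2_norm h u"
proof -
  let ?s = "\<lambda>j k. u (k + h *\<^sub>R axis j 1) + u (k - h *\<^sub>R axis j 1)"
  have s: "?s j \<in> ell2 h \<and> ell2_norm h (?s j) \<le> 2 * ell2_norm h u" for j
  proof -
    have 1: "(\<lambda>k. u (k + h *\<^sub>R axis j 1)) \<in> ell2 h"
      "ell2_norm h (\<lambda>k. u (k + h *\<^sub>R axis j 1)) \<le> ell2_norm h u"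
      using lattice_hZ_shift by (auto intro!: ell2_reindex[OF u] inj_onI)
    have 2: "(\<lambda>k. u (k - h *\<^sub>R axis j 1)) \<in> ell2 h"
      "ell2_norm h (\<lambda>k. u (k - h *\<^sub>R axis j 1)) \<le> ell2_norm h u"
      using lattice_hZ_shift by (auto intro!: ell2_reindex[OF u] inj_onI)
    show ?thesis using ell2_add[OF 1(1) 2(1)] 1 2 by auto
  qed
  have S: "(\<lambda>k. \<Sum>j\<in>UNIV. ?s j k) \<in> ell2 h"
    "ell2_norm h (\<lambda>k. \<Sum>j\<in>UNIV. ?s j k) \<le> real CARD('n) * (2 * ell2_norm h u)"
    using ell2_sum[of UNIV ?s h] s sum_bounded_above[of UNIV "\<lambda>j. ell2_norm h (?s j)" "2 * ell2_norm h u"]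
    by (auto intro: order.trans)
  have R: "(\<lambda>k. 2 * of_nat CARD('n) * u k) \<in> ell2 h"
    "ell2_norm h (\<lambda>k. 2 * of_nat CARD('n) * u k) \<le> 2 * real CARD('n) * ell2_norm h u"
    using ell2_mult[OF u, of "2 * of_nat CARD('n)"] by (auto simp: norm_mult)
  have eq: "discrete_laplacian h u = (\<lambda>k. (\<Sum>j\<in>UNIV. ?s j k) - 2 * of_nat CARD('n) * u k)"
    by (auto simp: discrete_laplacian_def)
  show "discrete_laplacian h u \<in> ell2 h"
    "ell2_norm h (discrete_laplacian h u) \<le> 4 * real CARD('n) * ell2_norm h u"
    unfolding eq using ell2_diff[OF S(1) R(1)] S R by auto
qed

text \<open>Minkowski's inequality for integrals taken coordinate by coordinate. On a finite set of lattice
  points the vector \<open>?I\<close> of integrals is paired with its own conjugate; the pairing moves under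
  the integral sign, and Cauchy-Schwarz at each time bounds the square of the norm of \<open>?I\<close>
  by the norm of \<open>?I\<close> times the integral of \<open>N\<close>.\<close>

lemma ell2_norm_integral_le:
  assumes F: "\<And>k. k \<in> lattice_hZ h \<Longrightarrow> (\<lambda>s. F s k) integrable_on {c..d}"
    and N: "N integrable_on {c..d}"
    and le: "\<And>s. s \<in> {c..d} \<Longrightarrow> F s \<in> ell2 h \<and> ell2_norm h (F s) \<le> N s"
  shows "(\<lambda>k. integral {c..d} (\<lambda>s. F s k)) \<in> ell2 h"
    "ell2_norm h (\<lambda>k. integral {c..d} (\<lambda>s. F s k)) \<le> integral {c..d} N"
proof -
  let ?I = "\<lambda>k. integral {c..d} (\<lambda>s. F s k)"
  have N0: "0 \<le> integral {c..d} N"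
    using le by (intro integral_nonneg N) (meson ell2_norm_nonneg order_trans)
  have *: "L2_set (\<lambda>k. cmod (?I k)) K \<le> integral {c..d} N"
    if K: "finite K" "K \<subseteq> lattice_hZ h" for K
  proof -
    let ?R = "L2_set (\<lambda>k. cmod (?I k)) K"
    have "((\<lambda>s. \<Sum>k\<in>K. cnj (?I k) * F s k) has_integral (\<Sum>k\<in>K. cnj (?I k) * ?I k)) {c..d}"
      using K F by (intro has_integral_sum has_integral_mult_right integrable_integral) auto
    moreover have "((\<lambda>s. ?R * N s) has_integral ?R * integral {c..d} N) {c..d}"
      by (intro has_integral_mult_right integrable_integral N)
    moreover have "cmod (\<Sum>k\<in>K. cnj (?I k) * F s k) \<le> ?R * N s" if "s \<in> {c..d}" for s
    proof -
      have "cmod (\<Sum>k\<in>K. cnj (?I k) * F s k) \<le> (\<Sum>k\<in>K. \<bar>cmod (?I k)\<bar> * \<bar>cmod (F s k)\<bar>)"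
        by (rule order.trans[OF norm_sum]) (simp add: norm_mult)
      also have "\<dots> \<le> ?R * L2_set (\<lambda>k. cmod (F s k)) K"
        by (rule L2_set_mult_ineq)
      also have "\<dots> \<le> ?R * N s"
        using le[OF that] L2_set_le_ell2_norm[OF _ K, of "F s"]
        by (intro mult_left_mono) auto
      finally show ?thesis .
    qed
    ultimately have "cmod (\<Sum>k\<in>K. cnj (?I k) * ?I k) \<le> ?R * integral {c..d} N"
      by (metis (no_types, lifting) has_integral_integrable integral_norm_bound_integral integral_unique)
    moreover have "(\<Sum>k\<in>K. cnj (?I k) * ?I k) = of_real (?R\<^sup>2)"
      by (auto simp: L2_set_def sum_nonneg complex_norm_square[symmetric] mult.commute[of "cnj _"])
    ultimately have "?R * ?R \<le> ?R * integral {c..d} N"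
      by (simp add: power2_eq_square norm_mult)
    then show ?thesis
      using N0 by (cases "?R = 0") (auto simp: mult_le_cancel_left L2_set_nonneg less_le)
  qed
  show "?I \<in> ell2 h" "ell2_norm h ?I \<le> integral {c..d} N"
    by (rule ell2_normI[OF N0 *]; simp)+
qed

section \<open>Square integrable data\<close>

lemma borel_measurable_AE_LIMSEQ:
  fixes s :: "nat \<Rightarrow> 'a::euclidean_space \<Rightarrow> 'b::euclidean_space"
  assumes S: "S \<in> sets lebesgue"
    and s: "\<And>i. s i \<in> borel_measurable (lebesgue_on S)"
    and lim: "AE t in lebesgue_on S. (\<lambda>i. s i t) \<longlonglongrightarrow> g t"
  shows "g \<in> borel_measurable (lebesgue_on S)"
proof -
  let ?s = "\<lambda>i t. if t \<in> S then s i t else 0" and ?g = "\<lambda>t. if t \<in> S then g t else 0"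
  have "?s i \<in> borel_measurable lebesgue" for i
    using s[of i] S by (simp add: borel_measurable_if)
  then have "(\<lambda>t. lim (\<lambda>i. ?s i t)) \<in> borel_measurable lebesgue"
    by (rule borel_measurable_lim_metric)
  moreover have "AE t in lebesgue. lim (\<lambda>i. ?s i t) = ?g t"
    using lim S by (auto simp: AE_restrict_space_iff elim!: eventually_mono intro: limI)
  ultimately have "?g \<in> borel_measurable lebesgue"
    by (rule borel_measurable_AE)
  then show ?thesis
    using S by (simp add: borel_measurable_if)
qed

text \<open>Norm convergence of the simple functions in the definition of strong measurability implies
  convergence at each lattice point.\<close>

lemma L2_ell2_coordinate_measurable:
  assumes f: "f \<in> L2_ell2 h T" and k: "k \<in> lattice_hZ h"
  shows "(\<lambda>t. f t k) \<in> borel_measurable (lebesgue_on {0..T})"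
proof -
  obtain s where s: "\<And>i. simple_function (lebesgue_on {0..T}) (s i)"
    "\<And>i t. t \<in> {0..T} \<Longrightarrow> s i t \<in> ell2 h"
    and lim: "AE t in lebesgue_on {0..T}. (\<lambda>i. ell2_norm h (\<lambda>k. s i t k - f t k)) \<longlonglongrightarrow> 0"
    using f unfolding L2_ell2_def ell2_strongly_measurable_def by blast
  have f2: "f t \<in> ell2 h" if "t \<in> {0..T}" for t
    using f that by (auto simp: L2_ell2_def)
  show ?thesis
  proof (rule borel_measurable_AE_LIMSEQ)
    show "(\<lambda>t. s i t k) \<in> borel_measurable (lebesgue_on {0..T})" for i
      using simple_function_compose1[OF s(1), of "\<lambda>x. x k"] by (rule borel_measurable_simple_function)
    show "AE t in lebesgue_on {0..T}. (\<lambda>i. s i t k) \<longlonglongrightarrow> f t k"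
      using lim AE_space
    proof eventually_elim
      case (elim t)
      then have t: "t \<in> {0..T}" by simp
      show ?case
      proof (rule LIM_zero_cancel, rule tendsto_0_le[OF elim(1), of _ 1])
        show "\<forall>\<^sub>F i in sequentially. norm (s i t k - f t k) \<le> norm (ell2_norm h (\<lambda>k. s i t k - f t k)) * 1"
          using cmod_le_ell2_norm[OF ell2_diff(1)[OF s(2)[OF t] f2[OF t]] k] by simp
      qed
    qed
  qed simp
qed

text \<open>On the bounded interval the norm of \<open>f\<close> is dominated by \<open>1\<close> plus its square, so it is
  integrable; the proof of existence and the energy estimate integrate the norm itself.\<close>

lemma L2_ell2_norm_facts:
  assumes f: "f \<in> L2_ell2 h T"
  shows "(\<lambda>t. (ell2_norm h (f t))\<^sup>2) integrable_on {0..T}"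
    "(\<lambda>t. ell2_norm h (f t)) integrable_on {0..T}"
    "(L2_ell2_norm h T f)\<^sup>2 = integral {0..T} (\<lambda>t. (ell2_norm h (f t))\<^sup>2)"
proof -
  have i: "integrable (lebesgue_on {0..T}) (\<lambda>t. (ell2_norm h (f t))\<^sup>2)"
    using f by (auto simp: L2_ell2_def)
  then show 1: "(\<lambda>t. (ell2_norm h (f t))\<^sup>2) integrable_on {0..T}"
    by (intro integrable_on_lebesgue_on) auto
  show "(L2_ell2_norm h T f)\<^sup>2 = integral {0..T} (\<lambda>t. (ell2_norm h (f t))\<^sup>2)"
    unfolding L2_ell2_norm_def
    by (subst lebesgue_integral_eq_integral[symmetric, OF i]) (auto intro!: integral_nonneg_AE)
  have "(\<lambda>t. sqrt ((ell2_norm h (f t))\<^sup>2)) \<in> borel_measurable (lebesgue_on {0..T})"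
    using borel_measurable_integrable[OF i] by measurable
  then have "(\<lambda>t. ell2_norm h (f t)) \<in> borel_measurable (lebesgue_on {0..T})"
    by simp
  moreover have "(\<lambda>t. 1 + (ell2_norm h (f t))\<^sup>2) integrable_on {0..T}"
    by (intro integrable_add 1 integrable_const_ivl)
  moreover have "norm (ell2_norm h (f t)) \<le> 1 + (ell2_norm h (f t))\<^sup>2" for t
  proof -
    have "0 \<le> (ell2_norm h (f t) - 1)\<^sup>2" by simp
    then have "2 * ell2_norm h (f t) \<le> 1 + (ell2_norm h (f t))\<^sup>2"
      by (simp add: power2_diff)
    then have "ell2_norm h (f t) \<le> 1 + (ell2_norm h (f t))\<^sup>2"
      using ell2_norm_nonneg[of h "f t"] by linarith
    then show ?thesis by simp
  qed
  ultimately show "(\<lambda>t. ell2_norm h (f t)) integrable_on {0..T}"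
    by (rule measurable_bounded_by_integrable_imp_integrable) simp
qed

text \<open>Square integrability of the norm of the difference presupposes that this norm is a measurable
  function of time, which strong measurability of the difference provides: simple functions
  with values in \<open>ell2 h\<close> have norms that are real simple functions.\<close>

lemma L2_ell2_diff:
  assumes f: "f \<in> L2_ell2 h T" and g: "g \<in> L2_ell2 h T"
  shows "(\<lambda>t k. g t k - f t k) \<in> L2_ell2 h T"
proof -
  let ?D = "\<lambda>t k. g t k - f t k"
  have f2: "f t \<in> ell2 h" and g2: "g t \<in> ell2 h" if "t \<in> {0..T}" for t
    using f g that by (auto simp: L2_ell2_def)
  then have D2: "?D t \<in> ell2 h" if "t \<in> {0..T}" for t
    using that by (intro ell2_diff)
  obtain s where s: "\<And>i. simple_function (lebesgue_on {0..T}) (s i)"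
    "\<And>i t. t \<in> {0..T} \<Longrightarrow> s i t \<in> ell2 h"
    and slim: "AE t in lebesgue_on {0..T}. (\<lambda>i. ell2_norm h (\<lambda>k. s i t k - f t k)) \<longlonglongrightarrow> 0"
    using f unfolding L2_ell2_def ell2_strongly_measurable_def by blast
  obtain r where r: "\<And>i. simple_function (lebesgue_on {0..T}) (r i)"
    "\<And>i t. t \<in> {0..T} \<Longrightarrow> r i t \<in> ell2 h"
    and rlim: "AE t in lebesgue_on {0..T}. (\<lambda>i. ell2_norm h (\<lambda>k. r i t k - g t k)) \<longlonglongrightarrow> 0"
    using g unfolding L2_ell2_def ell2_strongly_measurable_def by blast
  define d where "d i t k = r i t k - s i t k" for i t k
  have d: "simple_function (lebesgue_on {0..T}) (d i)" for i
  proof -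
    have "d i = (\<lambda>t. (\<lambda>x y k. x k - y k) (r i t) (s i t))" by (auto simp: d_def fun_eq_iff)
    then show ?thesis
      using simple_function_compose2[OF r(1) s(1), of "\<lambda>x y k. x k - y k"] by simp
  qed
  have d2: "d i t \<in> ell2 h" if "t \<in> {0..T}" for i t
    unfolding d_def[abs_def] using that by (intro ell2_diff r s)
  have dlim: "AE t in lebesgue_on {0..T}. (\<lambda>i. ell2_norm h (\<lambda>k. d i t k - ?D t k)) \<longlonglongrightarrow> 0"
    using slim rlim AE_space
  proof eventually_elim
    case (elim t)
    then have t: "t \<in> {0..T}" by simp
    have le: "ell2_norm h (\<lambda>k. d i t k - ?D t k)
        \<le> ell2_norm h (\<lambda>k. r i t k - g t k) + ell2_norm h (\<lambda>k. s i t k - f t k)" for i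
      using ell2_diff(2)[OF ell2_diff(1)[OF r(2)[OF t] g2[OF t]] ell2_diff(1)[OF s(2)[OF t] f2[OF t]], of i i]
      by (simp add: d_def algebra_simps)
    show ?case
      by (rule tendsto_sandwich[OF _ _ tendsto_const tendsto_add_zero[OF elim(2,1)]]) (use le in auto)
  qed
  have meas: "(\<lambda>t. ell2_norm h (?D t)) \<in> borel_measurable (lebesgue_on {0..T})"
  proof (rule borel_measurable_AE_LIMSEQ)
    show "(\<lambda>t. ell2_norm h (d i t)) \<in> borel_measurable (lebesgue_on {0..T})" for i
      using simple_function_compose1[OF d, of "ell2_norm h"] by (rule borel_measurable_simple_function)
    show "AE t in lebesgue_on {0..T}. (\<lambda>i. ell2_norm h (d i t)) \<longlonglongrightarrow> ell2_norm h (?D t)"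
      using dlim AE_space
    proof eventually_elim
      case (elim t)
      then have t: "t \<in> {0..T}" by simp
      show ?case
      proof (rule LIM_zero_cancel, rule tendsto_0_le[OF elim(1), of _ 1])
        show "\<forall>\<^sub>F i in sequentially. norm (ell2_norm h (d i t) - ell2_norm h (?D t))
            \<le> norm (ell2_norm h (\<lambda>k. d i t k - ?D t k)) * 1"
          using ell2_norm_triangle_diff[OF d2[OF t] D2[OF t]] by simp
      qed
    qed
  qed simp
  have "integrable (lebesgue_on {0..T}) (\<lambda>t. (ell2_norm h (?D t))\<^sup>2)"
  proof (rule Bochner_Integration.integrable_bound)
    show "integrable (lebesgue_on {0..T}) (\<lambda>t. 2 * (ell2_norm h (g t))\<^sup>2 + 2 * (ell2_norm h (f t))\<^sup>2)"
      using f g by (auto simp: L2_ell2_def)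
    show "(\<lambda>t. (ell2_norm h (?D t))\<^sup>2) \<in> borel_measurable (lebesgue_on {0..T})"
      using meas by measurable
    show "AE t in lebesgue_on {0..T}. norm ((ell2_norm h (?D t))\<^sup>2)
        \<le> norm (2 * (ell2_norm h (g t))\<^sup>2 + 2 * (ell2_norm h (f t))\<^sup>2)"
      using AE_space
    proof eventually_elim
      case (elim t)
      then have t: "t \<in> {0..T}" by simp
      have "(ell2_norm h (?D t))\<^sup>2 \<le> (ell2_norm h (g t) + ell2_norm h (f t))\<^sup>2"
        using ell2_diff(2)[OF g2[OF t] f2[OF t]] by (intro power_mono) auto
      also have "\<dots> \<le> 2 * (ell2_norm h (g t))\<^sup>2 + 2 * (ell2_norm h (f t))\<^sup>2"
        using sum_squares_bound[of "ell2_norm h (g t)" "ell2_norm h (f t)"]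
        by (simp add: power2_sum)
      finally show ?case by simp
    qed
  qed
  moreover have "ell2_strongly_measurable h T ?D"
    unfolding ell2_strongly_measurable_def
    by (intro exI[of _ d] conjI allI ballI d d2 dlim)
  ultimately show ?thesis
    using D2 by (simp add: L2_ell2_def)
qed

section \<open>Absolute continuity in the sequence space\<close>

lemma AE_lebesgue_on_negligible:
  assumes "AE t in lebesgue_on S. P t" "S \<in> sets lebesgue"
  obtains N where "negligible N" "\<And>t. t \<in> S - N \<Longrightarrow> P t"
proof -
  have "AE t in lebesgue. t \<in> S \<longrightarrow> P t"
    using assms by (simp add: AE_restrict_space_iff)
  then obtain N where "N \<in> null_sets lebesgue" "{t. \<not> (t \<in> S \<longrightarrow> P t)} \<subseteq> N"
    by (auto simp: eventually_ae_filter)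
  then show thesis
    using that[of N] by (auto simp: negligible_iff_null_sets)
qed

lemma negligible_AE_lebesgue_on:
  assumes "negligible N" "\<And>t. t \<in> S - N \<Longrightarrow> P t" "S \<in> sets lebesgue"
  shows "AE t in lebesgue_on S. P t"
proof -
  have "AE t in lebesgue. t \<in> S \<longrightarrow> P t"
    using assms(1,2) by (intro AE_I'[of N]) (auto simp: negligible_iff_null_sets)
  then show ?thesis
    using assms(3) by (simp add: AE_restrict_space_iff)
qed

lemma ddt_eqI:
  assumes "T > 0" "t \<in> {0..T}" "((\<lambda>s. u s k) has_vector_derivative d) (at t within {0..T})"
  shows "ddt T u t k = d"
  unfolding ddt_def by (rule vector_derivative_within_closed_interval[OF assms])

lemma has_vector_derivative_ddt:
  assumes "(\<lambda>s. u s k) differentiable (at t within {0..T})"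
  shows "((\<lambda>s. u s k) has_vector_derivative ddt T u t k) (at t within {0..T})"
  unfolding ddt_def using assms by (simp add: vector_derivative_works)

lemma ell2_absolutely_continuousE:
  assumes "ell2_absolutely_continuous h T g" "\<epsilon> > 0"
  obtains \<delta> where "\<delta> > 0" "\<forall>(n::nat) c d. (\<forall>i<n. 0 \<le> c i \<and> c i \<le> d i \<and> d i \<le> T) \<longrightarrow>
      disjoint_family_on (\<lambda>i. {c i<..<d i}) {..<n} \<longrightarrow> (\<Sum>i<n. d i - c i) < \<delta> \<longrightarrow>
      (\<Sum>i<n. ell2_norm h (\<lambda>k. g (d i) k - g (c i) k)) < \<epsilon>"
  using assms(1)[unfolded ell2_absolutely_continuous_def, rule_format (no_asm), OF assms(2)]
  unfolding imp_conjL by (elim exE conjE) (rule that)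

lemma ell2_absolutely_continuousI:
  assumes "\<And>\<epsilon>. \<epsilon> > 0 \<Longrightarrow> \<exists>\<delta>>0. \<forall>(n::nat) c d. (\<forall>i<n. 0 \<le> c i \<and> c i \<le> d i \<and> d i \<le> T) \<longrightarrow>
      disjoint_family_on (\<lambda>i. {c i<..<d i}) {..<n} \<longrightarrow> (\<Sum>i<n. d i - c i) < \<delta> \<longrightarrow>
      (\<Sum>i<n. ell2_norm h (\<lambda>k. g (d i) k - g (c i) k)) < \<epsilon>"
  shows "ell2_absolutely_continuous h T g"
  using assms unfolding ell2_absolutely_continuous_def imp_conjL by blast

text \<open>A time derivative \<open>ddt T u\<close> is pinned down only on the interval and on the lattice, so a
  property of it is transferred from an explicit formula that agrees with it there.\<close>

lemma ell2_absolutely_continuous_cong: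
  fixes g g' :: "real \<Rightarrow> real ^ 'n \<Rightarrow> complex"
  assumes "\<And>t k. t \<in> {0..T} \<Longrightarrow> k \<in> lattice_hZ h \<Longrightarrow> g t k = g' t k"
    and "ell2_absolutely_continuous h T g"
  shows "ell2_absolutely_continuous h T g'"
proof -
  have eq: "(\<Sum>i<n. ell2_norm h (\<lambda>k. g' (d i) k - g' (c i) k))
      = (\<Sum>i<n. ell2_norm h (\<lambda>k. g (d i) k - g (c i) k))"
    if "\<forall>i<n. 0 \<le> c i \<and> c i \<le> d i \<and> d i \<le> T" for n and c d :: "nat \<Rightarrow> real"
  proof (intro sum.cong refl ell2_norm_cong)
    fix i and k :: "real ^ 'n" assume "i \<in> {..<n}" "k \<in> lattice_hZ h"
    then show "g' (d i) k - g' (c i) k = g (d i) k - g (c i) k"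
      using assms(1)[of "d i" k] assms(1)[of "c i" k] that by force
  qed
  show ?thesis
  proof (rule ell2_absolutely_continuousI)
    fix \<epsilon> :: real assume "\<epsilon> > 0"
    obtain \<delta> where "\<delta> > 0" and \<delta>: "\<forall>(n::nat) c d. (\<forall>i<n. 0 \<le> c i \<and> c i \<le> d i \<and> d i \<le> T) \<longrightarrow>
        disjoint_family_on (\<lambda>i. {c i<..<d i}) {..<n} \<longrightarrow> (\<Sum>i<n. d i - c i) < \<delta> \<longrightarrow>
        (\<Sum>i<n. ell2_norm h (\<lambda>k. g (d i) k - g (c i) k)) < \<epsilon>"
      by (rule ell2_absolutely_continuousE[OF assms(2) \<open>\<epsilon> > 0\<close>]) (rule that)
    show "\<exists>\<delta>>0. \<forall>(n::nat) c d. (\<forall>i<n. 0 \<le> c i \<and> c i \<le> d i \<and> d i \<le> T) \<longrightarrow>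
        disjoint_family_on (\<lambda>i. {c i<..<d i}) {..<n} \<longrightarrow> (\<Sum>i<n. d i - c i) < \<delta> \<longrightarrow>
        (\<Sum>i<n. ell2_norm h (\<lambda>k. g' (d i) k - g' (c i) k)) < \<epsilon>"
      using \<open>\<delta> > 0\<close> \<delta> eq by (intro exI[of _ \<delta>]) simp
  qed
qed

lemma ell2_absolutely_continuous_diff:
  assumes g: "ell2_absolutely_continuous h T g" "\<And>t. t \<in> {0..T} \<Longrightarrow> g t \<in> ell2 h"
    and f: "ell2_absolutely_continuous h T f" "\<And>t. t \<in> {0..T} \<Longrightarrow> f t \<in> ell2 h"
  shows "ell2_absolutely_continuous h T (\<lambda>t k. g t k - f t k)"
proof (rule ell2_absolutely_continuousI)
  fix \<epsilon> :: real assume "\<epsilon> > 0"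
  then have "\<epsilon> / 2 > 0" by simp
  obtain \<delta>1 where "\<delta>1 > 0" and \<delta>1: "\<forall>(n::nat) c d. (\<forall>i<n. 0 \<le> c i \<and> c i \<le> d i \<and> d i \<le> T) \<longrightarrow>
      disjoint_family_on (\<lambda>i. {c i<..<d i}) {..<n} \<longrightarrow> (\<Sum>i<n. d i - c i) < \<delta>1 \<longrightarrow>
      (\<Sum>i<n. ell2_norm h (\<lambda>k. g (d i) k - g (c i) k)) < \<epsilon> / 2"
    by (rule ell2_absolutely_continuousE[OF g(1) \<open>\<epsilon> / 2 > 0\<close>]) (rule that)
  obtain \<delta>2 where "\<delta>2 > 0" and \<delta>2: "\<forall>(n::nat) c d. (\<forall>i<n. 0 \<le> c i \<and> c i \<le> d i \<and> d i \<le> T) \<longrightarrow>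
      disjoint_family_on (\<lambda>i. {c i<..<d i}) {..<n} \<longrightarrow> (\<Sum>i<n. d i - c i) < \<delta>2 \<longrightarrow>
      (\<Sum>i<n. ell2_norm h (\<lambda>k. f (d i) k - f (c i) k)) < \<epsilon> / 2"
    by (rule ell2_absolutely_continuousE[OF f(1) \<open>\<epsilon> / 2 > 0\<close>]) (rule that)
  show "\<exists>\<delta>>0. \<forall>(n::nat) c d. (\<forall>i<n. 0 \<le> c i \<and> c i \<le> d i \<and> d i \<le> T) \<longrightarrow>
      disjoint_family_on (\<lambda>i. {c i<..<d i}) {..<n} \<longrightarrow> (\<Sum>i<n. d i - c i) < \<delta> \<longrightarrow>
      (\<Sum>i<n. ell2_norm h (\<lambda>k. (g (d i) k - f (d i) k) - (g (c i) k - f (c i) k))) < \<epsilon>"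
  proof (intro exI[of _ "min \<delta>1 \<delta>2"] conjI allI impI)
    fix n and c d :: "nat \<Rightarrow> real"
    assume A: "\<forall>i<n. 0 \<le> c i \<and> c i \<le> d i \<and> d i \<le> T"
      "disjoint_family_on (\<lambda>i. {c i<..<d i}) {..<n}" "(\<Sum>i<n. d i - c i) < min \<delta>1 \<delta>2"
    have "(\<Sum>i<n. ell2_norm h (\<lambda>k. (g (d i) k - f (d i) k) - (g (c i) k - f (c i) k)))
        \<le> (\<Sum>i<n. ell2_norm h (\<lambda>k. g (d i) k - g (c i) k) + ell2_norm h (\<lambda>k. f (d i) k - f (c i) k))"
    proof (rule sum_mono)
      fix i assume "i \<in> {..<n}"
      with A have cd: "c i \<in> {0..T}" "d i \<in> {0..T}" by force+
      have "ell2_norm h (\<lambda>k. (g (d i) k - g (c i) k) - (f (d i) k - f (c i) k))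
          \<le> ell2_norm h (\<lambda>k. g (d i) k - g (c i) k) + ell2_norm h (\<lambda>k. f (d i) k - f (c i) k)"
        using cd by (intro ell2_diff g f)
      then show "ell2_norm h (\<lambda>k. (g (d i) k - f (d i) k) - (g (c i) k - f (c i) k))
          \<le> ell2_norm h (\<lambda>k. g (d i) k - g (c i) k) + ell2_norm h (\<lambda>k. f (d i) k - f (c i) k)"
        by (simp add: algebra_simps)
    qed
    moreover have "(\<Sum>i<n. ell2_norm h (\<lambda>k. g (d i) k - g (c i) k)) < \<epsilon> / 2"
      using A by (intro \<delta>1[rule_format]) auto
    moreover have "(\<Sum>i<n. ell2_norm h (\<lambda>k. f (d i) k - f (c i) k)) < \<epsilon> / 2"
      using A by (intro \<delta>2[rule_format]) auto
    ultimately show "(\<Sum>i<n. ell2_norm h (\<lambda>k. (g (d i) k - f (d i) k) - (g (c i) k - f (c i) k))) < \<epsilon>"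
      by (simp add: sum.distrib)
  qed (use \<open>\<delta>1 > 0\<close> \<open>\<delta>2 > 0\<close> in auto)
qed

text \<open>Absolute continuity with a single interval is continuity in norm.\<close>

lemma continuous_on_ell2_norm:
  assumes ac: "ell2_absolutely_continuous h T g" and g: "\<And>t. t \<in> {0..T} \<Longrightarrow> g t \<in> ell2 h"
  shows "continuous_on {0..T} (\<lambda>t. ell2_norm h (g t))"
  unfolding continuous_on_iff
proof (intro ballI allI impI)
  fix t \<epsilon> :: real assume t: "t \<in> {0..T}" and "\<epsilon> > 0"
  obtain \<delta> where "\<delta> > 0" and \<delta>: "\<forall>(n::nat) c d. (\<forall>i<n. 0 \<le> c i \<and> c i \<le> d i \<and> d i \<le> T) \<longrightarrow>
      disjoint_family_on (\<lambda>i. {c i<..<d i}) {..<n} \<longrightarrow> (\<Sum>i<n. d i - c i) < \<delta> \<longrightarrow>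
      (\<Sum>i<n. ell2_norm h (\<lambda>k. g (d i) k - g (c i) k)) < \<epsilon>"
    by (rule ell2_absolutely_continuousE[OF ac \<open>\<epsilon> > 0\<close>]) (rule that)
  have less: "\<bar>ell2_norm h (g q) - ell2_norm h (g p)\<bar> < \<epsilon>"
    if "0 \<le> p" "p \<le> q" "q \<le> T" "q - p < \<delta>" for p q
  proof -
    have "ell2_norm h (\<lambda>k. g q k - g p k) < \<epsilon>"
      using \<delta>[THEN spec, of 1, THEN spec, of "\<lambda>_. p", THEN spec, of "\<lambda>_. q"] that
      by (simp add: disjoint_family_on_def)
    then show ?thesis
      using ell2_norm_triangle_diff[OF g[of q] g[of p]] that by simp
  qed
  show "\<exists>\<delta>>0. \<forall>s\<in>{0..T}. dist s t < \<delta> \<longrightarrow> dist (ell2_norm h (g s)) (ell2_norm h (g t)) < \<epsilon>"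
  proof (intro exI[of _ \<delta>] conjI ballI impI \<open>\<delta> > 0\<close>)
    fix s assume s: "s \<in> {0..T}" "dist s t < \<delta>"
    show "dist (ell2_norm h (g s)) (ell2_norm h (g t)) < \<epsilon>"
    proof (cases "s \<le> t")
      case True
      then show ?thesis
        using less[of s t] s t by (simp add: dist_real_def abs_minus_commute)
    next
      case False
      then show ?thesis
        using less[of t s] s t by (simp add: dist_real_def)
    qed
  qed
qed

section \<open>Second-order equations with a bounded generator\<close>

text \<open>The abstract equation \<open>u'' = G(t) u + f\<close>. Compatibility with differences and
  measurability are asked for coordinate by coordinate, which is the form in which \<open>G\<close> enters the integrals. The
  operators may depend on \<open>t\<close> in a merely measurable way, but their norms are bounded by one
  constant \<open>M\<close>; every estimate below depends on \<open>G\<close> through \<open>M\<close> only.\<close>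

locale bounded_generator =
  fixes h T M :: real and G :: "real \<Rightarrow> (real ^ 'n \<Rightarrow> complex) \<Rightarrow> real ^ 'n \<Rightarrow> complex"
  assumes T_pos: "T > 0" and M_nonneg: "M \<ge> 0"
    and G_ell2: "\<And>t x. t \<in> {0..T} \<Longrightarrow> x \<in> ell2 h \<Longrightarrow> G t x \<in> ell2 h"
    and G_bound: "\<And>t x. t \<in> {0..T} \<Longrightarrow> x \<in> ell2 h \<Longrightarrow> ell2_norm h (G t x) \<le> M * ell2_norm h x"
    and G_diff: "\<And>t x y k. G t (\<lambda>k. x k - y k) k = G t x k - G t y k"
    and G_measurable: "\<And>x k. (\<And>k. k \<in> lattice_hZ h \<Longrightarrow> continuous_on {0..T} (\<lambda>t. x t k)) \<Longrightarrow>
      k \<in> lattice_hZ h \<Longrightarrow> (\<lambda>t. G t (x t) k) \<in> borel_measurable (lebesgue_on {0..T})"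
begin

definition solves ::
    "(real ^ 'n \<Rightarrow> complex) \<Rightarrow> (real ^ 'n \<Rightarrow> complex) \<Rightarrow> (real \<Rightarrow> real ^ 'n \<Rightarrow> complex) \<Rightarrow>
     (real \<Rightarrow> real ^ 'n \<Rightarrow> complex) \<Rightarrow> bool" where
  "solves u0 u1 f u \<longleftrightarrow>
     (\<forall>t\<in>{0..T}. \<forall>k\<in>lattice_hZ h. (\<lambda>s. u s k) differentiable (at t within {0..T})) \<and>
     (\<forall>t\<in>{0..T}. u t \<in> ell2 h \<and> ddt T u t \<in> ell2 h) \<and>
     ell2_absolutely_continuous h T u \<and>
     ell2_absolutely_continuous h T (ddt T u) \<and>
     (AE t in lebesgue_on {0..T}. \<forall>k\<in>lattice_hZ h.
        (\<lambda>s. ddt T u s k) differentiable (at t within {0..T}) \<and>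
        ddt T (ddt T u) t k = G t (u t) k + f t k) \<and>
     (\<forall>k\<in>lattice_hZ h. u 0 k = u0 k) \<and>
     (\<forall>k\<in>lattice_hZ h. ddt T u 0 k = u1 k)"

text \<open>The equation is linear, so all questions of uniqueness and continuous dependence reduce to the
  energy estimate for the difference of two solutions.\<close>

lemma solves_diff:
  assumes u: "solves u0 u1 f u" and w: "solves w0 w1 g w"
  shows "solves (\<lambda>k. w0 k - u0 k) (\<lambda>k. w1 k - u1 k) (\<lambda>t k. g t k - f t k) (\<lambda>t k. w t k - u t k)"
    "\<And>t k. t \<in> {0..T} \<Longrightarrow> k \<in> lattice_hZ h \<Longrightarrow>
       ddt T (\<lambda>t k. w t k - u t k) t k = ddt T w t k - ddt T u t k"
proof -
  let ?z = "\<lambda>t k. w t k - u t k"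
  have der: "((\<lambda>s. ?z s k) has_vector_derivative ddt T w t k - ddt T u t k) (at t within {0..T})"
    if "t \<in> {0..T}" "k \<in> lattice_hZ h" for t k
    using u w that unfolding solves_def
    by (intro has_vector_derivative_diff has_vector_derivative_ddt) auto
  show ddt: "ddt T ?z t k = ddt T w t k - ddt T u t k" if "t \<in> {0..T}" "k \<in> lattice_hZ h" for t k
    by (rule ddt_eqI[where u = ?z and k = k, OF T_pos that(1) der[OF that]])
  have ell: "ddt T ?z t \<in> ell2 h" if "t \<in> {0..T}" for t
  proof -
    have "(\<lambda>k. ddt T w t k - ddt T u t k) \<in> ell2 h"
      using u w that unfolding solves_def by (intro ell2_diff) auto
    then show ?thesis
      using ell2_cong[of h "ddt T ?z t" "\<lambda>k. ddt T w t k - ddt T u t k"] ddt[OF that] by blast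
  qed
  have ac: "ell2_absolutely_continuous h T (ddt T ?z)"
    by (rule ell2_absolutely_continuous_cong[OF _ ell2_absolutely_continuous_diff[of h T "ddt T w" "ddt T u"]])
       (use u w ddt in \<open>auto simp: solves_def\<close>)
  have "AE t in lebesgue_on {0..T}. \<forall>k\<in>lattice_hZ h.
        (\<lambda>s. ddt T u s k) differentiable (at t within {0..T}) \<and>
        ddt T (ddt T u) t k = G t (u t) k + f t k"
    "AE t in lebesgue_on {0..T}. \<forall>k\<in>lattice_hZ h.
        (\<lambda>s. ddt T w s k) differentiable (at t within {0..T}) \<and>
        ddt T (ddt T w) t k = G t (w t) k + g t k"
    using u w unfolding solves_def by blast+
  then have "AE t in lebesgue_on {0..T}. \<forall>k\<in>lattice_hZ h.
        (\<lambda>s. ddt T ?z s k) differentiable (at t within {0..T}) \<and>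
        ddt T (ddt T ?z) t k = G t (?z t) k + (g t k - f t k)"
    using AE_space
  proof eventually_elim
    case (elim t)
    then have t: "t \<in> {0..T}" by simp
    show ?case
    proof
      fix k :: "real ^ 'n" assume k: "k \<in> lattice_hZ h"
      have "((\<lambda>s. ddt T w s k - ddt T u s k) has_vector_derivative
          ddt T (ddt T w) t k - ddt T (ddt T u) t k) (at t within {0..T})"
        using elim k by (intro has_vector_derivative_diff has_vector_derivative_ddt) auto
      then have D: "((\<lambda>s. ddt T ?z s k) has_vector_derivative
          ddt T (ddt T w) t k - ddt T (ddt T u) t k) (at t within {0..T})"
        by (rule has_vector_derivative_transform[OF t, rotated]) (use ddt k in auto)
      then have "ddt T (ddt T ?z) t k = ddt T (ddt T w) t k - ddt T (ddt T u) t k"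
        by (rule ddt_eqI[where u = "ddt T ?z" and k = k, OF T_pos t])
      then show "(\<lambda>s. ddt T ?z s k) differentiable (at t within {0..T}) \<and>
        ddt T (ddt T ?z) t k = G t (?z t) k + (g t k - f t k)"
        using elim k D by (auto simp: G_diff differentiableI_vector)
    qed
  qed
  moreover have "ell2_absolutely_continuous h T ?z"
    using u w unfolding solves_def by (intro ell2_absolutely_continuous_diff) auto
  moreover have "?z t \<in> ell2 h" if "t \<in> {0..T}" for t
    using u w that unfolding solves_def by (intro ell2_diff) auto
  moreover have "(\<lambda>s. ?z s k) differentiable (at t within {0..T})"
    if "t \<in> {0..T}" "k \<in> lattice_hZ h" for t k
    using der[OF that] by (rule differentiableI_vector)
  moreover have "ddt T ?z 0 k = w1 k - u1 k" if "k \<in> lattice_hZ h" for k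
    using ddt[of 0 k] that u w T_pos unfolding solves_def by auto
  moreover have "?z 0 k = w0 k - u0 k" if "k \<in> lattice_hZ h" for k
    using that u w unfolding solves_def by auto
  ultimately show "solves (\<lambda>k. w0 k - u0 k) (\<lambda>k. w1 k - u1 k) (\<lambda>t k. g t k - f t k) ?z"
    unfolding solves_def using ell ac by simp
qed

text \<open>A solution satisfies the integrated equations at every time: \<open>u\<close> is differentiable
  everywhere, and \<open>ddt T u\<close> is absolutely continuous at each lattice point because the
  absolute value there is at most the norm.\<close>

lemma solves_integral:
  assumes u: "solves u0 u1 f u" and t: "t \<in> {0..T}" and k: "k \<in> lattice_hZ h"
  shows "((\<lambda>s. ddt T u s k) has_integral u t k - u0 k) {0..t}"
    "((\<lambda>s. G s (u s) k + f s k) has_integral ddt T u t k - u1 k) {0..t}"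
proof -
  have "((\<lambda>s. ddt T u s k) has_integral u t k - u 0 k) {0..t}"
  proof (rule fundamental_theorem_of_calculus)
    fix s assume "s \<in> {0..t}"
    then have "((\<lambda>s. u s k) has_vector_derivative ddt T u s k) (at s within {0..T})"
      using u t k unfolding solves_def by (intro has_vector_derivative_ddt) auto
    then show "((\<lambda>s. u s k) has_vector_derivative ddt T u s k) (at s within {0..t})"
      by (rule has_vector_derivative_within_subset) (use t in auto)
  qed (use t in auto)
  then show "((\<lambda>s. ddt T u s k) has_integral u t k - u0 k) {0..t}"
    using u k unfolding solves_def by simp
  have "AE t in lebesgue_on {0..T}. \<forall>k\<in>lattice_hZ h.
        (\<lambda>s. ddt T u s k) differentiable (at t within {0..T}) \<and>
        ddt T (ddt T u) t k = G t (u t) k + f t k"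
    using u unfolding solves_def by blast
  then obtain N where N: "negligible N"
    "\<And>t. t \<in> {0..T} - N \<Longrightarrow> \<forall>k\<in>lattice_hZ h.
        (\<lambda>s. ddt T u s k) differentiable (at t within {0..T}) \<and>
        ddt T (ddt T u) t k = G t (u t) k + f t k"
    by (rule AE_lebesgue_on_negligible) auto
  have "((\<lambda>s. G s (u s) k + f s k) has_integral ddt T u t k - ddt T u 0 k) {0..t}"
  proof (rule has_integral_ae_derivative_of_absolutely_continuous[OF _ N(1)])
    fix s assume s: "s \<in> {0..t} - N"
    then have "((\<lambda>s. ddt T u s k) has_vector_derivative ddt T (ddt T u) s k) (at s within {0..T})"
      using N(2)[of s] t k by (intro has_vector_derivative_ddt) auto
    then have "((\<lambda>s. ddt T u s k) has_vector_derivative G s (u s) k + f s k) (at s within {0..T})"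
      using N(2)[of s] s t k by auto
    then show "((\<lambda>s. ddt T u s k) has_vector_derivative G s (u s) k + f s k) (at s within {0..t})"
      by (rule has_vector_derivative_within_subset) (use t in auto)
  next
    fix \<epsilon> :: real assume "\<epsilon> > 0"
    have ac: "ell2_absolutely_continuous h T (ddt T u)" using u unfolding solves_def by blast
    obtain \<delta> where "\<delta> > 0" and \<delta>: "\<forall>(n::nat) c d. (\<forall>i<n. 0 \<le> c i \<and> c i \<le> d i \<and> d i \<le> T) \<longrightarrow>
        disjoint_family_on (\<lambda>i. {c i<..<d i}) {..<n} \<longrightarrow> (\<Sum>i<n. d i - c i) < \<delta> \<longrightarrow>
        (\<Sum>i<n. ell2_norm h (\<lambda>k. ddt T u (d i) k - ddt T u (c i) k)) < \<epsilon>"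
      by (rule ell2_absolutely_continuousE[OF ac \<open>\<epsilon> > 0\<close>]) (rule that)
    show "\<exists>\<delta>>0. \<forall>(n::nat) c d. (\<forall>i<n. 0 \<le> c i \<and> c i \<le> d i \<and> d i \<le> t) \<and>
        disjoint_family_on (\<lambda>i. {c i<..<d i}) {..<n} \<and> (\<Sum>i<n. d i - c i) < \<delta> \<longrightarrow>
        (\<Sum>i<n. norm (ddt T u (d i) k - ddt T u (c i) k)) < \<epsilon>"
    proof (intro exI[of _ \<delta>] conjI allI impI \<open>\<delta> > 0\<close>)
      fix n and c d :: "nat \<Rightarrow> real"
      assume A: "(\<forall>i<n. 0 \<le> c i \<and> c i \<le> d i \<and> d i \<le> t) \<and>
        disjoint_family_on (\<lambda>i. {c i<..<d i}) {..<n} \<and> (\<Sum>i<n. d i - c i) < \<delta>"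
      have "(\<Sum>i<n. norm (ddt T u (d i) k - ddt T u (c i) k))
          \<le> (\<Sum>i<n. ell2_norm h (\<lambda>k. ddt T u (d i) k - ddt T u (c i) k))"
      proof (rule sum_mono)
        fix i assume "i \<in> {..<n}"
        with A t have "c i \<in> {0..T}" "d i \<in> {0..T}" by force+
        then show "norm (ddt T u (d i) k - ddt T u (c i) k)
            \<le> ell2_norm h (\<lambda>k. ddt T u (d i) k - ddt T u (c i) k)"
          using u k unfolding solves_def by (intro cmod_le_ell2_norm ell2_diff) auto
      qed
      also have "\<dots> < \<epsilon>"
        using A t by (intro \<delta>[rule_format]) force+
      finally show "(\<Sum>i<n. norm (ddt T u (d i) k - ddt T u (c i) k)) < \<epsilon>" .
    qed
  qed (use t in auto)
  then show "((\<lambda>s. G s (u s) k + f s k) has_integral ddt T u t k - u1 k) {0..t}"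
    using u k unfolding solves_def by simp
qed

definition growth :: real where
  "growth = exp ((1 + M) * T)"

text \<open>By Minkowski's inequality the integrated equations bound the energy
  \<open>E t = \<parallel>u t\<parallel> + \<parallel>ddt T u t\<parallel>\<close> by the data plus the integral of \<open>\<parallel>ddt T u\<parallel> + M \<parallel>u\<parallel>\<close>, which is at
  most \<open>1 + M\<close> times the integral of \<open>E\<close>. Since \<open>E\<close> is continuous, Gronwall's inequality
  applies. The factor \<open>sqrt T\<close> comes from the integral of \<open>\<parallel>f\<parallel>\<close> being at most
  \<open>sqrt T\<close> times the \<open>L\<^sup>2\<close> norm of \<open>f\<close>.\<close>

lemma energy_estimate:
  assumes u0: "u0 \<in> ell2 h" and u1: "u1 \<in> ell2 h" and f: "f \<in> L2_ell2 h T"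
    and u: "solves u0 u1 f u" and t: "t \<in> {0..T}"
  shows "ell2_norm h (u t) + ell2_norm h (ddt T u t)
    \<le> growth * (ell2_norm h u0 + ell2_norm h u1 + sqrt T * L2_ell2_norm h T f)"
proof -
  let ?E = "\<lambda>t. ell2_norm h (u t) + ell2_norm h (ddt T u t)"
  let ?F = "\<lambda>s. ell2_norm h (f s)"
  have ell: "u s \<in> ell2 h" "ddt T u s \<in> ell2 h" "f s \<in> ell2 h" if "s \<in> {0..T}" for s
    using u f that by (auto simp: solves_def L2_ell2_def)
  have cu: "continuous_on {0..T} (\<lambda>t. ell2_norm h (u t))"
    and cv: "continuous_on {0..T} (\<lambda>t. ell2_norm h (ddt T u t))"
    using u by (auto simp: solves_def intro!: continuous_on_ell2_norm)
  have iu: "(\<lambda>s. ell2_norm h (u s)) integrable_on {0..t}"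
    and iv: "(\<lambda>s. ell2_norm h (ddt T u s)) integrable_on {0..t}" if "t \<in> {0..T}" for t
    using that by (auto intro!: integrable_continuous_real continuous_on_subset[OF cu] continuous_on_subset[OF cv])
  have if': "?F integrable_on {0..t}" if "t \<in> {0..T}" for t
    by (rule integrable_subinterval_real[OF L2_ell2_norm_facts(2)[OF f]]) (use that in auto)
  define D where "D = ell2_norm h u0 + ell2_norm h u1 + integral {0..T} ?F"
  have E: "?E t \<le> D + (1 + M) * integral {0..t} ?E" if t: "t \<in> {0..T}" for t
  proof -
    have sub: "s \<in> {0..T}" if "s \<in> {0..t}" for s using that t by auto
    have "ell2_norm h (u t) \<le> ell2_norm h u0 + integral {0..t} (\<lambda>s. ell2_norm h (ddt T u s))"
    proof -
      let ?I = "\<lambda>k. integral {0..t} (\<lambda>s. ddt T u s k)"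
      have I: "?I \<in> ell2 h" "ell2_norm h ?I \<le> integral {0..t} (\<lambda>s. ell2_norm h (ddt T u s))"
        using solves_integral(1)[OF u t] ell sub
        by (auto intro!: ell2_norm_integral_le iv t)
      have "ell2_norm h (u t) = ell2_norm h (\<lambda>k. u0 k + ?I k)"
        using integral_unique[OF solves_integral(1)[OF u t]] by (intro ell2_norm_cong) simp
      then show ?thesis
        using ell2_add(2)[OF u0 I(1)] I(2) by linarith
    qed
    moreover have "ell2_norm h (ddt T u t)
        \<le> ell2_norm h u1 + integral {0..t} (\<lambda>s. M * ell2_norm h (u s) + ?F s)"
    proof -
      let ?I = "\<lambda>k. integral {0..t} (\<lambda>s. G s (u s) k + f s k)"
      have le: "(\<lambda>k. G s (u s) k + f s k) \<in> ell2 h \<and>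
          ell2_norm h (\<lambda>k. G s (u s) k + f s k) \<le> M * ell2_norm h (u s) + ?F s" if "s \<in> {0..t}" for s
        using ell2_add[OF G_ell2 ell(3), OF sub[OF that] ell(1), OF sub[OF that] sub[OF that]]
          G_bound[OF sub ell(1), OF that sub[OF that]] by linarith
      have I: "?I \<in> ell2 h" "ell2_norm h ?I \<le> integral {0..t} (\<lambda>s. M * ell2_norm h (u s) + ?F s)"
        by (rule ell2_norm_integral_le[OF has_integral_integrable[OF solves_integral(2)[OF u t]] _ le];
            (intro integrable_add integrable_on_mult_right iu if' t)?; assumption)+
      have "ell2_norm h (ddt T u t) = ell2_norm h (\<lambda>k. u1 k + ?I k)"
        using integral_unique[OF solves_integral(2)[OF u t]] by (intro ell2_norm_cong) simp
      then show ?thesis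
        using ell2_add(2)[OF u1 I(1)] I(2) by linarith
    qed
    moreover have "integral {0..t} (\<lambda>s. M * ell2_norm h (u s) + ?F s)
        = M * integral {0..t} (\<lambda>s. ell2_norm h (u s)) + integral {0..t} ?F"
      using iu[OF t] if'[OF t] by (simp add: integral_add integrable_on_mult_right)
    moreover have "integral {0..t} ?F \<le> integral {0..T} ?F"
      using t if' T_pos by (intro integral_subset_le) auto
    moreover have "integral {0..t} ?E = integral {0..t} (\<lambda>s. ell2_norm h (u s))
        + integral {0..t} (\<lambda>s. ell2_norm h (ddt T u s))"
      by (rule integral_add[OF iu[OF t] iv[OF t]])
    moreover have "0 \<le> integral {0..t} (\<lambda>s. ell2_norm h (u s))"
      "0 \<le> M * integral {0..t} (\<lambda>s. ell2_norm h (ddt T u s))"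
      using M_nonneg iu[OF t] iv[OF t] by (auto intro!: integral_nonneg mult_nonneg_nonneg)
    ultimately show ?thesis
      unfolding D_def by (simp add: algebra_simps)
  qed
  have "?E t \<le> D * exp ((1 + M) * t)"
    by (rule gronwall_integral[OF continuous_on_add[OF cu cv] _ E t]) (use M_nonneg in auto)
  also have "\<dots> \<le> D * growth"
  proof (rule mult_left_mono)
    show "0 \<le> D"
      unfolding D_def using integral_nonneg[OF if'[of T]] T_pos by simp
  qed (use t M_nonneg in \<open>auto simp: growth_def intro!: mult_left_mono\<close>)
  also have "D \<le> ell2_norm h u0 + ell2_norm h u1 + sqrt T * L2_ell2_norm h T f"
  proof -
    have "(integral {0..T} ?F)\<^sup>2 \<le> T * (L2_ell2_norm h T f)\<^sup>2"
      using integral_square_le[of 0 T ?F] T_pos L2_ell2_norm_facts[OF f] by simp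
    then have "integral {0..T} ?F \<le> sqrt (T * (L2_ell2_norm h T f)\<^sup>2)"
      by (rule real_le_rsqrt)
    also have "\<dots> = sqrt T * L2_ell2_norm h T f"
      by (simp add: real_sqrt_mult L2_ell2_norm_def)
    finally show ?thesis by (simp add: D_def)
  qed
  finally show ?thesis
    by (simp add: growth_def mult.commute)
qed

end

section \<open>Primitives of functions with values in the sequence space\<close>

lemma sum_integral_disjoint_le:
  fixes g :: "real \<Rightarrow> real"
  assumes g: "g integrable_on {a..b}" "\<And>s. s \<in> {a..b} \<Longrightarrow> 0 \<le> g s"
    and cd: "\<And>i. i < n \<Longrightarrow> a \<le> c i \<and> c i \<le> d i \<and> d i \<le> b"
    and disj: "disjoint_family_on (\<lambda>i. {c i<..<d i}) {..<n::nat}"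
  shows "(\<Sum>i<n. integral {c i..d i} g) \<le> integral {a..b} g"
proof -
  let ?r = "\<lambda>i s. if s \<in> {c i<..<d i} then g s else 0"
  have "(?r i has_integral integral {c i..d i} g) {a..b}" if "i < n" for i
  proof -
    have "g integrable_on {c i..d i}"
      by (rule integrable_subinterval_real[OF g(1)]) (use cd[OF that] in auto)
    then have "(g has_integral integral {c i..d i} g) {c i<..<d i}"
      by (simp add: has_integral_Icc_iff_Ioo[symmetric] integrable_integral)
    then show ?thesis
      by (subst has_integral_restrict) (use cd[OF that] in auto)
  qed
  then have "((\<lambda>s. \<Sum>i<n. ?r i s) has_integral (\<Sum>i<n. integral {c i..d i} g)) {a..b}"
    by (intro has_integral_sum) auto
  moreover have "(\<Sum>i<n. ?r i s) \<le> g s" if s: "s \<in> {a..b}" for s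
  proof (cases "\<exists>i<n. s \<in> {c i<..<d i}")
    case True
    then obtain i where i: "i < n" "s \<in> {c i<..<d i}" by blast
    have "(\<Sum>j<n. ?r j s) = (\<Sum>j<n. if j = i then g s else 0)"
    proof (intro sum.cong refl)
      fix j assume "j \<in> {..<n}"
      then show "?r j s = (if j = i then g s else 0)"
        using disjoint_family_onD[OF disj, of i j] i by (cases "j = i") auto
    qed
    then show ?thesis using i by simp
  next
    case False
    then have "(\<Sum>i<n. ?r i s) = 0" by (intro sum.neutral) auto
    then show ?thesis using g(2)[OF s] by simp
  qed
  ultimately show ?thesis
    using has_integral_le integrable_integral[OF g(1)] by blast
qed

text \<open>Balls around \<open>0\<close> are closed under convergence at each lattice point, since the norm is a
  supremum over finite sets of lattice points. This takes the part of completeness of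
  \<open>ell2 h\<close> in the construction of solutions.\<close>

lemma ell2_lim:
  assumes x: "\<And>m. x m \<in> ell2 h" "\<And>m. m \<ge> start \<Longrightarrow> ell2_norm h (x m) \<le> B" and "B \<ge> 0"
    and lim: "\<And>k. k \<in> lattice_hZ h \<Longrightarrow> (\<lambda>m. x m k) \<longlonglongrightarrow> y k"
  shows "y \<in> ell2 h" "ell2_norm h y \<le> B"
proof -
  have *: "L2_set (\<lambda>k. cmod (y k)) K \<le> B" if K: "finite K" "K \<subseteq> lattice_hZ h" for K
  proof (rule LIMSEQ_le_const2)
    show "(\<lambda>m. L2_set (\<lambda>k. cmod (x m k)) K) \<longlonglongrightarrow> L2_set (\<lambda>k. cmod (y k)) K"
      unfolding L2_set_def using K lim by (intro tendsto_intros) auto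
    show "\<exists>N. \<forall>m\<ge>N. L2_set (\<lambda>k. cmod (x m k)) K \<le> B"
      using L2_set_le_ell2_norm[OF x(1) K] x(2) by (meson order_trans)
  qed
  show "y \<in> ell2 h" "ell2_norm h y \<le> B"
    by (rule ell2_normI[OF \<open>B \<ge> 0\<close> *]; simp)+
qed

text \<open>The Bochner integrability that the construction uses, expressed by integrability at each lattice
  point and a real integrable majorant \<open>N\<close> of the norm.\<close>

definition ell2_majorised ::
    "real \<Rightarrow> real \<Rightarrow> (real \<Rightarrow> real) \<Rightarrow> (real \<Rightarrow> real ^ 'n \<Rightarrow> complex) \<Rightarrow> bool" where
  "ell2_majorised h T N F \<longleftrightarrow>
     (\<forall>k\<in>lattice_hZ h. (\<lambda>s. F s k) integrable_on {0..T}) \<and>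
     (\<forall>s\<in>{0..T}. F s \<in> ell2 h \<and> ell2_norm h (F s) \<le> N s) \<and> N integrable_on {0..T}"

text \<open>The increments of \<open>V\<close> are bounded by integrals of the majorant \<open>N\<close>. When \<open>N\<close> is square
  integrable, these are small over families of intervals of small total length, because
  \<open>N \<le> \<Lambda> + N\<^sup>2 / \<Lambda>\<close> for every \<open>\<Lambda> > 0\<close>: a large \<open>\<Lambda>\<close> makes the second term
  small, whereupon the lengths make the first one small.\<close>

lemma ell2_const_add_primitive:
  fixes F :: "real \<Rightarrow> real ^ 'n \<Rightarrow> complex"
  assumes maj: "ell2_majorised h T N F" and w: "w \<in> ell2 h"
    and V_def: "V = (\<lambda>t k. w k + integral {0..t} (\<lambda>s. F s k))"
  shows "\<And>k. k \<in> lattice_hZ h \<Longrightarrow> continuous_on {0..T} (\<lambda>t. V t k)"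
    "\<And>t. t \<in> {0..T} \<Longrightarrow> V t \<in> ell2 h"
    "\<And>t. t \<in> {0..T} \<Longrightarrow> ell2_norm h (V t) \<le> ell2_norm h w + integral {0..t} N"
    "(\<lambda>s. (N s)\<^sup>2) integrable_on {0..T} \<Longrightarrow> ell2_absolutely_continuous h T V"
proof -
  have F: "(\<lambda>s. F s k) integrable_on {0..T}" if "k \<in> lattice_hZ h" for k
    using maj that by (simp add: ell2_majorised_def)
  have ell: "F s \<in> ell2 h" "ell2_norm h (F s) \<le> N s" if "s \<in> {0..T}" for s
    using maj that by (auto simp: ell2_majorised_def)
  have N: "N integrable_on {0..T}"
    using maj by (simp add: ell2_majorised_def)
  show "continuous_on {0..T} (\<lambda>t. V t k)" if "k \<in> lattice_hZ h" for k
    unfolding V_def using F[OF that] by (intro continuous_intros indefinite_integral_continuous_1)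
  have *: "(\<lambda>k. integral {c..d} (\<lambda>s. F s k)) \<in> ell2 h"
    "ell2_norm h (\<lambda>k. integral {c..d} (\<lambda>s. F s k)) \<le> integral {c..d} N"
    if "0 \<le> c" "d \<le> T" for c d
  proof -
    have sub: "(\<lambda>s. F s k) integrable_on {c..d}" if "k \<in> lattice_hZ h" for k
      by (rule integrable_subinterval_real[OF F[OF that]]) (use \<open>0 \<le> c\<close> \<open>d \<le> T\<close> in auto)
    have subN: "N integrable_on {c..d}"
      by (rule integrable_subinterval_real[OF N]) (use that in auto)
    show "(\<lambda>k. integral {c..d} (\<lambda>s. F s k)) \<in> ell2 h"
      "ell2_norm h (\<lambda>k. integral {c..d} (\<lambda>s. F s k)) \<le> integral {c..d} N"
      by (rule ell2_norm_integral_le[OF sub subN]; use ell that in auto)+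
  qed
  show "V t \<in> ell2 h" "ell2_norm h (V t) \<le> ell2_norm h w + integral {0..t} N" if "t \<in> {0..T}" for t
    using ell2_add[OF w *(1)[of 0 t]] *(2)[of 0 t] that unfolding V_def by auto
  show "ell2_absolutely_continuous h T V" if N2: "(\<lambda>s. (N s)\<^sup>2) integrable_on {0..T}"
  proof (rule ell2_absolutely_continuousI)
    fix \<epsilon> :: real assume "\<epsilon> > 0"
    define I where "I = integral {0..T} (\<lambda>s. (N s)\<^sup>2)"
    have "I \<ge> 0" unfolding I_def by (intro integral_nonneg N2) auto
    \<comment> \<open>The summand 1 keeps the threshold positive when the function vanishes.\<close>
    define \<Lambda> where "\<Lambda> = 2 * (I + 1) / \<epsilon>"
    have "\<Lambda> > 0" using \<open>I \<ge> 0\<close> \<open>\<epsilon> > 0\<close> by (simp add: \<Lambda>_def)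
    have I\<Lambda>: "I / \<Lambda> < \<epsilon> / 2" using \<open>I \<ge> 0\<close> \<open>\<epsilon> > 0\<close> by (simp add: \<Lambda>_def field_simps)
    have N0: "0 \<le> N s" if "s \<in> {0..T}" for s
      using ell(2)[OF that] ell2_norm_nonneg order_trans by blast
    have NL: "N s \<le> \<Lambda> + (N s)\<^sup>2 / \<Lambda>" if "s \<in> {0..T}" for s
    proof (cases "N s \<le> \<Lambda>")
      case False
      then have "\<Lambda> * N s \<le> N s * N s" using N0[OF that] by (intro mult_right_mono) auto
      then have "N s \<le> (N s)\<^sup>2 / \<Lambda>"
        using \<open>\<Lambda> > 0\<close> by (simp add: field_simps power2_eq_square)
      then show ?thesis using \<open>\<Lambda> > 0\<close> by linarith
    qed (use \<open>\<Lambda> > 0\<close> in \<open>simp add: add_increasing2\<close>)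
    show "\<exists>\<delta>>0. \<forall>(n::nat) c d. (\<forall>i<n. 0 \<le> c i \<and> c i \<le> d i \<and> d i \<le> T) \<longrightarrow>
      disjoint_family_on (\<lambda>i. {c i<..<d i}) {..<n} \<longrightarrow> (\<Sum>i<n. d i - c i) < \<delta> \<longrightarrow>
      (\<Sum>i<n. ell2_norm h (\<lambda>k. V (d i) k - V (c i) k)) < \<epsilon>"
    proof (intro exI[of _ "\<epsilon> / (2 * \<Lambda>)"] conjI allI impI)
      fix n and c d :: "nat \<Rightarrow> real"
      assume cd: "\<forall>i<n. 0 \<le> c i \<and> c i \<le> d i \<and> d i \<le> T"
        and disj: "disjoint_family_on (\<lambda>i. {c i<..<d i}) {..<n}"
        and small: "(\<Sum>i<n. d i - c i) < \<epsilon> / (2 * \<Lambda>)"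
      have "(\<Sum>i<n. ell2_norm h (\<lambda>k. V (d i) k - V (c i) k))
          \<le> (\<Sum>i<n. \<Lambda> * (d i - c i) + integral {c i..d i} (\<lambda>s. (N s)\<^sup>2) / \<Lambda>)"
      proof (rule sum_mono)
        fix i assume "i \<in> {..<n}"
        then have i: "0 \<le> c i" "c i \<le> d i" "d i \<le> T" using cd by auto
        have subN: "N integrable_on {c i..d i}"
          by (rule integrable_subinterval_real[OF N]) (use i in auto)
        have subN2: "(\<lambda>s. (N s)\<^sup>2) integrable_on {c i..d i}"
          by (rule integrable_subinterval_real[OF N2]) (use i in auto)
        have "V (d i) k - V (c i) k = integral {c i..d i} (\<lambda>s. F s k)" if "k \<in> lattice_hZ h" for k
        proof -
          have "integral {0..c i} (\<lambda>s. F s k) + integral {c i..d i} (\<lambda>s. F s k) = integral {0..d i} (\<lambda>s. F s k)"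
            by (rule Henstock_Kurzweil_Integration.integral_combine)
               (use i integrable_subinterval_real[OF F[OF that], of 0 "d i"] in auto)
          then show ?thesis by (simp add: V_def algebra_simps)
        qed
        then have "ell2_norm h (\<lambda>k. V (d i) k - V (c i) k) \<le> integral {c i..d i} N"
          using *(2)[OF i(1) i(3)] ell2_norm_cong[of h "\<lambda>k. V (d i) k - V (c i) k"] by simp
        also have "\<dots> \<le> integral {c i..d i} (\<lambda>s. \<Lambda> + (N s)\<^sup>2 / \<Lambda>)"
          using i NL by (intro integral_le subN integrable_add integrable_const_ivl integrable_on_divide subN2) auto
        also have "\<dots> = \<Lambda> * (d i - c i) + integral {c i..d i} (\<lambda>s. (N s)\<^sup>2) / \<Lambda>"
          using i integrable_on_divide[OF subN2, of \<Lambda>]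
          by (subst integral_add) (auto simp: mult.commute)
        finally show "ell2_norm h (\<lambda>k. V (d i) k - V (c i) k)
            \<le> \<Lambda> * (d i - c i) + integral {c i..d i} (\<lambda>s. (N s)\<^sup>2) / \<Lambda>" .
      qed
      also have "\<dots> = \<Lambda> * (\<Sum>i<n. d i - c i) + (\<Sum>i<n. integral {c i..d i} (\<lambda>s. (N s)\<^sup>2)) / \<Lambda>"
        by (simp add: sum.distrib sum_distrib_left sum_divide_distrib)
      also have "\<dots> \<le> \<Lambda> * (\<epsilon> / (2 * \<Lambda>)) + I / \<Lambda>"
      proof (intro add_mono mult_left_mono divide_right_mono)
        show "(\<Sum>i<n. integral {c i..d i} (\<lambda>s. (N s)\<^sup>2)) \<le> I"
          unfolding I_def using cd disj by (intro sum_integral_disjoint_le N2) auto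
      qed (use small \<open>\<Lambda> > 0\<close> in auto)
      also have "\<dots> < \<epsilon>"
      proof -
        have "\<Lambda> * (\<epsilon> / (2 * \<Lambda>)) = \<epsilon> / 2" using \<open>\<Lambda> > 0\<close> by simp
        then show ?thesis using I\<Lambda> by linarith
      qed
      finally show "(\<Sum>i<n. ell2_norm h (\<lambda>k. V (d i) k - V (c i) k)) < \<epsilon>" .
    qed (use \<open>\<Lambda> > 0\<close> \<open>\<epsilon> > 0\<close> in auto)
  qed
qed

lemma integral_exp_le:
  fixes c C :: real
  assumes "c > 0" "C \<ge> 0" "t \<ge> 0"
  shows "(\<lambda>s. C * exp (c * s)) integrable_on {0..t}"
    "integral {0..t} (\<lambda>s. C * exp (c * s)) \<le> C / c * exp (c * t)"
proof -
  have "((\<lambda>s. C * exp (c * s)) has_integral C / c * exp (c * t) - C / c * exp (c * 0)) {0..t}"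
    using assms by (intro fundamental_theorem_of_calculus)
      (auto intro!: derivative_eq_intros simp: has_real_derivative_iff_has_vector_derivative[symmetric])
  note * = this
  show "(\<lambda>s. C * exp (c * s)) integrable_on {0..t}"
    using * by (rule has_integral_integrable)
  show "integral {0..t} (\<lambda>s. C * exp (c * s)) \<le> C / c * exp (c * t)"
    by (subst integral_unique[OF *]) (use assms in simp)
qed

section \<open>Construction of solutions\<close>

context bounded_generator
begin

text \<open>Solutions come from the Volterra equation \<open>u = P + volterra u\<close>, where \<open>P\<close> collects the
  data. Measured against the weight \<open>exp (c t)\<close>, each integration in time gains a factor
  \<open>1 / c\<close>, so the double integral of \<open>G u\<close> has weighted norm at most
  \<open>M / c\<^sup>2\<close> times that of \<open>u\<close>. The rate
  \<open>c = 1 + 2 M\<close> makes this factor at most \<open>1 / 2\<close> for all \<open>M \<ge> 0\<close>, on the whole interval at once.\<close>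

definition weight :: "real \<Rightarrow> real" where "weight t = exp ((1 + 2 * M) * t)"

definition dominated :: "real \<Rightarrow> (real \<Rightarrow> real ^ 'n \<Rightarrow> complex) \<Rightarrow> bool" where
  "dominated K x \<longleftrightarrow> K \<ge> 0 \<and> (\<forall>k\<in>lattice_hZ h. continuous_on {0..T} (\<lambda>t. x t k)) \<and>
     (\<forall>t\<in>{0..T}. x t \<in> ell2 h \<and> ell2_norm h (x t) \<le> K * weight t)"

definition volterra :: "(real \<Rightarrow> real ^ 'n \<Rightarrow> complex) \<Rightarrow> real \<Rightarrow> real ^ 'n \<Rightarrow> complex" where
  "volterra x t k = integral {0..t} (\<lambda>s. integral {0..s} (\<lambda>r. G r (x r) k))"

lemma G_zero: "G t (\<lambda>k. 0) k = 0"
  using G_diff[of t "\<lambda>k. 0" "\<lambda>k. 0" k] by simp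

lemma weight_ge_1: "t \<ge> 0 \<Longrightarrow> weight t \<ge> 1"
  using M_nonneg by (simp add: weight_def)

lemma weight_mono: "t \<le> T \<Longrightarrow> weight t \<le> weight T"
  using M_nonneg by (simp add: weight_def mult_left_mono)

lemma dominated_G:
  assumes x: "dominated K x"
  shows "ell2_majorised h T (\<lambda>s. M * K * weight s) (\<lambda>s. G s (x s))"
proof -
  have 1: "G s (x s) \<in> ell2 h" if "s \<in> {0..T}" for s
    using x that G_ell2 by (auto simp: dominated_def)
  have 2: "ell2_norm h (G s (x s)) \<le> M * K * weight s" if "s \<in> {0..T}" for s
  proof -
    have "ell2_norm h (G s (x s)) \<le> M * ell2_norm h (x s)"
      using x that G_bound by (auto simp: dominated_def)
    also have "\<dots> \<le> M * (K * weight s)"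
      using x that M_nonneg by (intro mult_left_mono) (auto simp: dominated_def)
    finally show ?thesis by (simp add: mult.assoc)
  qed
  have 4: "(\<lambda>s. M * K * weight s) integrable_on {0..T}"
    unfolding weight_def by (intro integrable_continuous_real continuous_intros)
  have "(\<lambda>s. G s (x s) k) integrable_on {0..T}" if k: "k \<in> lattice_hZ h" for k
  proof (rule measurable_bounded_by_integrable_imp_integrable[OF _ 4])
    show "(\<lambda>s. G s (x s) k) \<in> borel_measurable (lebesgue_on {0..T})"
      using x k by (intro G_measurable) (auto simp: dominated_def)
    show "norm (G s (x s) k) \<le> M * K * weight s" if "s \<in> {0..T}" for s
      using cmod_le_ell2_norm[OF 1[OF that] k] 2[OF that] by linarith
  qed simp
  with 1 2 4 show ?thesis by (simp add: ell2_majorised_def)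
qed

lemma dominated_G_integrable:
  "dominated K x \<Longrightarrow> k \<in> lattice_hZ h \<Longrightarrow> (\<lambda>s. G s (x s) k) integrable_on {0..T}"
  using dominated_G by (simp add: ell2_majorised_def)

text \<open>The contraction property that \<open>weight\<close> is chosen for.\<close>

lemma dominated_volterra:
  assumes x: "dominated K x"
  shows "dominated (K / 2) (volterra x)"
proof -
  define c where "c = 1 + 2 * M"
  have c: "c > 0" using M_nonneg by (simp add: c_def)
  have weight: "weight = (\<lambda>s. exp (c * s))" by (auto simp: weight_def c_def)
  have K: "K \<ge> 0" using x by (simp add: dominated_def)
  let ?V = "\<lambda>s k. integral {0..s} (\<lambda>r. G r (x r) k)"
  note prim = ell2_const_add_primitive[OF dominated_G[OF x] ell2_zero(1) refl, unfolded ell2_zero(2) add_0]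
  have V: "ell2_norm h (?V s) \<le> M * K / c * weight s" if "s \<in> {0..T}" for s
    using prim(3)[OF that] integral_exp_le(2)[of c "M * K" s] c M_nonneg K that
    by (simp add: weight mult.assoc)
  have "(\<lambda>s. M * K / c * weight s) integrable_on {0..T}"
    unfolding weight by (intro integrable_continuous_real continuous_intros)
  then have "ell2_majorised h T (\<lambda>s. M * K / c * weight s) ?V"
    using prim V by (auto simp: ell2_majorised_def intro: integrable_continuous_real)
  note prim2 = ell2_const_add_primitive[OF this ell2_zero(1) refl, unfolded ell2_zero(2) add_0]
  have "ell2_norm h (volterra x t) \<le> K / 2 * weight t" if t: "t \<in> {0..T}" for t
  proof -
    have "ell2_norm h (volterra x t) \<le> integral {0..t} (\<lambda>s. M * K / c * exp (c * s))"
      using prim2(3)[OF t] by (simp add: volterra_def[abs_def] weight)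
    also have "\<dots> \<le> M * K / c / c * exp (c * t)"
      using integral_exp_le(2)[of c "M * K / c" t] c M_nonneg K t by simp
    also have "\<dots> \<le> K / 2 * exp (c * t)"
    proof (rule mult_right_mono)
      have "M * 2 \<le> c * c" using M_nonneg by (simp add: c_def algebra_simps)
      then have "K * (M * 2) \<le> K * (c * c)" using K by (rule mult_left_mono)
      then show "M * K / c / c \<le> K / 2"
        using c by (simp add: field_simps)
    qed simp
    finally show ?thesis by (simp add: weight)
  qed
  moreover have "volterra x t \<in> ell2 h" if "t \<in> {0..T}" for t
    using prim2(2)[OF that] by (simp add: volterra_def[abs_def])
  moreover have "continuous_on {0..T} (\<lambda>t. volterra x t k)" if "k \<in> lattice_hZ h" for k
    using prim2(1)[OF that] by (simp add: volterra_def)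
  ultimately show ?thesis
    using K by (simp add: dominated_def)
qed

lemma dominated_add:
  assumes "dominated K x" "dominated L y"
  shows "dominated (K + L) (\<lambda>t k. x t k + y t k)"
  unfolding dominated_def
proof (intro conjI ballI)
  fix t assume t: "t \<in> {0..T}"
  then have xy: "x t \<in> ell2 h" "ell2_norm h (x t) \<le> K * weight t"
    "y t \<in> ell2 h" "ell2_norm h (y t) \<le> L * weight t"
    using assms by (auto simp: dominated_def)
  show "(\<lambda>k. x t k + y t k) \<in> ell2 h"
    "ell2_norm h (\<lambda>k. x t k + y t k) \<le> (K + L) * weight t"
    using ell2_add[OF xy(1,3)] xy by (auto simp: distrib_right)
qed (use assms in \<open>auto simp: dominated_def intro!: continuous_intros\<close>)

lemma volterra_diff:
  assumes x: "dominated K x" and y: "dominated L y" and t: "t \<in> {0..T}" and k: "k \<in> lattice_hZ h"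
  shows "volterra (\<lambda>t k. x t k - y t k) t k = volterra x t k - volterra y t k"
proof -
  let ?V = "\<lambda>x s. integral {0..s} (\<lambda>r. G r (x r) k)"
  have inner: "(\<lambda>r. G r (z r) k) integrable_on {0..s}" if "dominated J z" "s \<in> {0..T}" for J z s
    by (rule integrable_subinterval_real[OF dominated_G_integrable[OF that(1) k]]) (use that in auto)
  have outer: "?V z integrable_on {0..t}" if "dominated J z" for J z
    using indefinite_integral_continuous_1[OF dominated_G_integrable[OF that k]] t
    by (intro integrable_continuous_real) (auto elim: continuous_on_subset)
  have "volterra (\<lambda>t k. x t k - y t k) t k = integral {0..t} (\<lambda>s. ?V x s - ?V y s)"
    unfolding volterra_def
  proof (rule integral_cong)
    fix s assume "s \<in> {0..t}"
    then have s: "s \<in> {0..T}" using t by auto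
    show "?V (\<lambda>t k. x t k - y t k) s = ?V x s - ?V y s"
      using inner[OF x s] inner[OF y s]
      by (simp add: G_diff integral_diff)
  qed
  also have "\<dots> = volterra x t k - volterra y t k"
    unfolding volterra_def by (rule integral_diff[OF outer[OF x] outer[OF y]])
  finally show ?thesis .
qed

text \<open>Picard iteration from \<open>0\<close>. The increments \<open>\<Delta> m\<close> are the iterated images of \<open>P\<close>, of
  weighted norm at most \<open>K / 2 ^ m\<close>. At each lattice point the iterates therefore converge
  uniformly in time, and \<open>ell2_lim\<close> carries the geometric bound on the remainder over to the
  limit, where the contraction property shows that the fixed-point equation survives.\<close>

lemma volterra_fixed_point:
  assumes P: "dominated K P"
  obtains u where "dominated (2 * K) u"
    "\<forall>t\<in>{0..T}. \<forall>k\<in>lattice_hZ h. u t k = P t k + volterra u t k"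
proof -
  have K: "K \<ge> 0" using P by (simp add: dominated_def)
  define X where "X = rec_nat (\<lambda>t k. 0) (\<lambda>m x t k. P t k + volterra x t k)"
  have X0: "X 0 = (\<lambda>t k. 0)" and XS: "X (Suc m) = (\<lambda>t k. P t k + volterra (X m) t k)" for m
    by (simp_all add: X_def)
  have X: "dominated (2 * K) (X m)" for m
  proof (induction m)
    case 0
    then show ?case using K by (simp add: X0 dominated_def weight_def)
  next
    case (Suc m)
    show ?case
      using dominated_add[OF P dominated_volterra[OF Suc]] by (simp add: XS)
  qed
  define \<Delta> where "\<Delta> m t k = X (Suc m) t k - X m t k" for m t k
  have \<Delta>: "\<Delta> m t \<in> ell2 h \<and> ell2_norm h (\<Delta> m t) \<le> K / 2 ^ m * weight t" if "t \<in> {0..T}" for m t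
  proof -
    \<comment> \<open>The increment is compared with a dominated function only on the interval and the lattice,
      since nothing is known about it elsewhere.\<close>
    have "\<exists>y. dominated (K / 2 ^ m) y \<and> (\<forall>t\<in>{0..T}. \<forall>k\<in>lattice_hZ h. \<Delta> m t k = y t k)"
    proof (induction m)
      case 0
      have "\<Delta> 0 t k = P t k" for t k
        by (simp add: \<Delta>_def X0 XS volterra_def G_zero)
      then show ?case using P by auto
    next
      case (Suc m)
      then obtain y where y: "dominated (K / 2 ^ m) y"
        "\<And>t k. t \<in> {0..T} \<Longrightarrow> k \<in> lattice_hZ h \<Longrightarrow> \<Delta> m t k = y t k" by blast
      have dom: "dominated (K / 2 ^ m) (\<Delta> m)"
        unfolding dominated_def
      proof (intro conjI ballI)
        fix t assume t: "t \<in> {0..T}"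
        show "\<Delta> m t \<in> ell2 h" "ell2_norm h (\<Delta> m t) \<le> K / 2 ^ m * weight t"
          using y t ell2_cong[of h "\<Delta> m t" "y t"] ell2_norm_cong[of h "\<Delta> m t" "y t"]
          by (auto simp: dominated_def)
      next
        fix k :: "real ^ 'n" assume "k \<in> lattice_hZ h"
        then show "continuous_on {0..T} (\<lambda>t. \<Delta> m t k)"
          using X[of m] X[of "Suc m"] unfolding \<Delta>_def dominated_def by (intro continuous_intros) auto
      qed (use K in auto)
      have "\<Delta> (Suc m) t k = volterra (\<Delta> m) t k" if "t \<in> {0..T}" "k \<in> lattice_hZ h" for t k
      proof -
        have "volterra (\<Delta> m) t k = volterra (X (Suc m)) t k - volterra (X m) t k"
          unfolding \<Delta>_def[abs_def] by (rule volterra_diff[OF X X that])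
        moreover have "X (Suc (Suc m)) t k = P t k + volterra (X (Suc m)) t k"
          "X (Suc m) t k = P t k + volterra (X m) t k"
          by (simp_all only: XS)
        ultimately show ?thesis
          unfolding \<Delta>_def[of "Suc m"] by simp
      qed
      moreover have "dominated (K / 2 ^ Suc m) (volterra (\<Delta> m))"
        using dominated_volterra[OF dom] by (simp add: mult.commute)
      ultimately show ?case by blast
    qed
    then obtain y where y: "dominated (K / 2 ^ m) y"
      and eq: "\<forall>t\<in>{0..T}. \<forall>k\<in>lattice_hZ h. \<Delta> m t k = y t k"
      by (elim exE conjE)
    have "\<Delta> m t \<in> ell2 h \<longleftrightarrow> y t \<in> ell2 h" "ell2_norm h (\<Delta> m t) = ell2_norm h (y t)"
      using eq that by (auto intro!: ell2_cong ell2_norm_cong)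
    then show ?thesis
      using y that by (simp add: dominated_def)
  qed
  have X_telescope: "(\<Sum>i<n. \<Delta> i t k) = X n t k" for n t k
    using sum_lessThan_telescope[of "\<lambda>n. X n t k" n] by (simp add: \<Delta>_def X0)
  define u where "u t k = (\<Sum>i. \<Delta> i t k)" for t k
  have unif: "uniform_limit {0..T} (\<lambda>n t. X n t k) (\<lambda>t. u t k) sequentially" if k: "k \<in> lattice_hZ h" for k
    unfolding u_def X_telescope[symmetric]
  proof (rule Weierstrass_m_test)
    show "norm (\<Delta> n t k) \<le> K * weight T * (1 / 2) ^ n" if t: "t \<in> {0..T}" for n t
    proof -
      have "norm (\<Delta> n t k) \<le> K / 2 ^ n * weight t"
        using cmod_le_ell2_norm[OF _ k] \<Delta>[OF t, of n] by (meson order_trans)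
      also have "\<dots> \<le> K / 2 ^ n * weight T"
        using K t weight_mono by (intro mult_left_mono) auto
      finally show ?thesis by (simp add: power_one_over field_simps)
    qed
    show "summable (\<lambda>n. K * weight T * (1 / 2) ^ n)"
      by (intro summable_mult summable_geometric) simp
  qed
  have lim: "(\<lambda>n. X n t k) \<longlonglongrightarrow> u t k" if "t \<in> {0..T}" "k \<in> lattice_hZ h" for t k
    using tendsto_uniform_limitI[OF unif[OF that(2)] that(1)] .
  have cont: "continuous_on {0..T} (\<lambda>t. u t k)" if "k \<in> lattice_hZ h" for k
    using X that by (intro uniform_limit_theorem[OF _ unif[OF that]]) (auto simp: dominated_def)
  have tail: "ell2_norm h (\<lambda>k. X m t k - X n t k) \<le> (2 * K / 2 ^ n - 2 * K / 2 ^ m) * weight t"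
    if t: "t \<in> {0..T}" and "m \<ge> n" for m n t
    using \<open>m \<ge> n\<close>
  proof (induction m rule: dec_induct)
    case base
    then show ?case by simp
  next
    case (step m)
    have x: "X m t \<in> ell2 h" for m using X[of m] t by (auto simp: dominated_def)
    have "ell2_norm h (\<lambda>k. X (Suc m) t k - X n t k)
        = ell2_norm h (\<lambda>k. \<Delta> m t k + (X m t k - X n t k))"
      by (simp add: \<Delta>_def)
    also have "\<dots> \<le> K / 2 ^ m * weight t + (2 * K / 2 ^ n - 2 * K / 2 ^ m) * weight t"
      using ell2_add(2)[of "\<Delta> m t" h "\<lambda>k. X m t k - X n t k"] \<Delta>[OF t, of m] ell2_diff(1)[OF x x] step.IH
      by fastforce
    also have "\<dots> = (2 * K / 2 ^ n - 2 * K / 2 ^ Suc m) * weight t"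
      by (simp add: algebra_simps)
    finally show ?case .
  qed
  have err: "dominated (2 * K / 2 ^ n) (\<lambda>t k. u t k - X n t k)" for n
    unfolding dominated_def
  proof (intro conjI ballI)
    fix t assume t: "t \<in> {0..T}"
    have x: "X m t \<in> ell2 h" for m using X[of m] t by (auto simp: dominated_def)
    have "ell2_norm h (\<lambda>k. X m t k - X n t k) \<le> 2 * K / 2 ^ n * weight t" if "m \<ge> n" for m
    proof -
      have "(2 * K / 2 ^ n - 2 * K / 2 ^ m) * weight t \<le> 2 * K / 2 ^ n * weight t"
        using K by (intro mult_right_mono) (auto simp: weight_def)
      then show ?thesis using tail[OF t that] by linarith
    qed
    moreover have "(\<lambda>m. X m t k - X n t k) \<longlonglongrightarrow> u t k - X n t k" if "k \<in> lattice_hZ h" for k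
      using lim[OF t that] by (intro tendsto_intros)
    ultimately show "(\<lambda>k. u t k - X n t k) \<in> ell2 h"
      "ell2_norm h (\<lambda>k. u t k - X n t k) \<le> 2 * K / 2 ^ n * weight t"
      using ell2_lim[where x="\<lambda>m k. X m t k - X n t k" and start=n and B="2 * K / 2 ^ n * weight t" and h=h
          and y="\<lambda>k. u t k - X n t k"] ell2_diff(1)[OF x x] K
      by (auto simp: weight_def)
  next
    fix k :: "real ^ 'n" assume "k \<in> lattice_hZ h"
    then show "continuous_on {0..T} (\<lambda>t. u t k - X n t k)"
      using cont X[of n] unfolding dominated_def by (intro continuous_intros) auto
  qed (use K in auto)
  have u: "dominated (2 * K) u"
    using err[of 0] by (simp add: X0)
  show thesis
  proof (rule that[OF u], intro ballI)
    fix t and k :: "real ^ 'n" assume t: "t \<in> {0..T}" and k: "k \<in> lattice_hZ h"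
    have le: "norm (volterra u t k - volterra (X n) t k) \<le> K * weight t * (1 / 2) ^ n" for n
    proof -
      have "norm (volterra (\<lambda>t k. u t k - X n t k) t k) \<le> 2 * K / 2 ^ n / 2 * weight t"
        using dominated_volterra[OF err[of n]] cmod_le_ell2_norm[OF _ k] t
        unfolding dominated_def by (meson order_trans)
      then show ?thesis
        by (simp add: volterra_diff[OF u X t k] power_one_over field_simps)
    qed
    have "(\<lambda>n. volterra u t k - volterra (X n) t k) \<longlonglongrightarrow> 0"
    proof (rule Lim_null_comparison[OF always_eventually, rule_format])
      show "(\<lambda>n. K * weight t * (1 / 2) ^ n) \<longlonglongrightarrow> 0"
        by (intro tendsto_mult_right_zero LIMSEQ_realpow_zero) auto
    qed (rule le)
    then have "(\<lambda>n. P t k + (volterra u t k - (volterra u t k - volterra (X n) t k)))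
        \<longlonglongrightarrow> P t k + (volterra u t k - 0)"
      by (intro tendsto_intros)
    then have "(\<lambda>n. X (Suc n) t k) \<longlonglongrightarrow> P t k + volterra u t k"
      by (simp add: XS)
    moreover have "(\<lambda>n. X (Suc n) t k) \<longlonglongrightarrow> u t k"
      using lim[OF t k] by (rule LIMSEQ_Suc)
    ultimately show "u t k = P t k + volterra u t k"
      by (rule LIMSEQ_unique[symmetric])
  qed
qed

text \<open>The fixed point is rewritten as \<open>u = u0 + \<integral> V\<close> with \<open>V = u1 + \<integral> H\<close> and \<open>H = G u + f\<close>.
  Here \<open>V\<close> is continuous, hence the derivative of \<open>u\<close> at every time, while \<open>H\<close> is
  only integrable: Lebesgue differentiation at each of the countably many lattice points yields one
  common null set of times outside which the equation holds. Absolute continuity of \<open>V\<close> uses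
  the square integrability of \<open>f\<close>.\<close>

lemma solution_exists:
  assumes u0: "u0 \<in> ell2 h" and u1: "u1 \<in> ell2 h" and f: "f \<in> L2_ell2 h T"
  obtains u where "solves u0 u1 f u"
proof -
  let ?N = "\<lambda>s. ell2_norm h (f s)"
  note fN = L2_ell2_norm_facts(2)[OF f]
  have f2: "f s \<in> ell2 h" if "s \<in> {0..T}" for s using f that by (auto simp: L2_ell2_def)
  have fint: "(\<lambda>s. f s k) integrable_on {0..T}" if "k \<in> lattice_hZ h" for k
    using cmod_le_ell2_norm[OF f2 that] L2_ell2_coordinate_measurable[OF f that]
    by (intro measurable_bounded_by_integrable_imp_integrable[OF _ fN]) auto
  define V1 where "V1 = (\<lambda>t k. u1 k + integral {0..t} (\<lambda>s. f s k))"
  have "ell2_majorised h T ?N f"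
    using fint f2 fN by (simp add: ell2_majorised_def)
  note V1 = ell2_const_add_primitive(1-3)[OF this u1 V1_def]
  define K1 where "K1 = ell2_norm h u1 + integral {0..T} ?N"
  have V1_le: "ell2_norm h (V1 t) \<le> K1" if "t \<in> {0..T}" for t
  proof -
    have "integral {0..t} ?N \<le> integral {0..T} ?N"
      using that integrable_subinterval_real[OF fN, of 0 t] by (intro integral_subset_le fN) auto
    then show ?thesis using V1(3)[OF that] by (simp add: K1_def)
  qed
  have K1: "K1 \<ge> 0" using order_trans[OF ell2_norm_nonneg V1_le[of 0]] T_pos by simp
  define P where "P = (\<lambda>t k. u0 k + integral {0..t} (\<lambda>s. V1 s k))"
  have "ell2_majorised h T (\<lambda>s. K1) V1"
    using V1 V1_le by (auto simp: ell2_majorised_def intro: integrable_continuous_real)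
  note P = ell2_const_add_primitive(1-3)[OF this u0 P_def]
  define K where "K = ell2_norm h u0 + T * K1"
  have "dominated K P"
    unfolding dominated_def
  proof (intro conjI ballI P)
    show K: "K \<ge> 0" using K1 T_pos by (simp add: K_def)
    fix t assume t: "t \<in> {0..T}"
    have "t * K1 \<le> T * K1" using t K1 by (intro mult_right_mono) auto
    then have "ell2_norm h (P t) \<le> K"
      using P(3)[OF t] t by (simp add: K_def)
    also have "\<dots> \<le> K * weight t"
      using K weight_ge_1[of t] t by (simp add: mult_le_cancel_left1)
    finally show "ell2_norm h (P t) \<le> K * weight t" .
  qed
  then obtain u where u: "dominated (2 * K) u"
    "\<forall>t\<in>{0..T}. \<forall>k\<in>lattice_hZ h. u t k = P t k + volterra u t k"
    by (rule volterra_fixed_point) (rule that)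
  have g: "G s (u s) \<in> ell2 h" "ell2_norm h (G s (u s)) \<le> M * (2 * K) * weight s" if "s \<in> {0..T}" for s
    using dominated_G[OF u(1)] that by (auto simp: ell2_majorised_def)
  note gint = dominated_G_integrable[OF u(1)]
  define H where "H = (\<lambda>s k. G s (u s) k + f s k)"
  define NH where "NH = (\<lambda>s. M * (2 * K) * weight T + ?N s)"
  have K0: "K \<ge> 0" using u(1) by (simp add: dominated_def)
  have Hint: "(\<lambda>s. H s k) integrable_on {0..T}" if "k \<in> lattice_hZ h" for k
    unfolding H_def by (intro integrable_add gint fint that)
  have H2: "H s \<in> ell2 h" if "s \<in> {0..T}" for s
    unfolding H_def using that by (intro ell2_add g f2)
  have HN: "ell2_norm h (H s) \<le> NH s" if s: "s \<in> {0..T}" for s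
  proof -
    have "ell2_norm h (H s) \<le> M * (2 * K) * weight s + ?N s"
      using ell2_add(2)[OF g(1)[OF s] f2[OF s]] g(2)[OF s] unfolding H_def by linarith
    also have "\<dots> \<le> NH s"
      using s weight_mono M_nonneg K0 unfolding NH_def
      by (intro add_right_mono mult_left_mono) auto
    finally show ?thesis .
  qed
  have NHint: "NH integrable_on {0..T}"
    unfolding NH_def by (intro integrable_add integrable_const_ivl fN)
  have NH2: "(\<lambda>s. (NH s)\<^sup>2) integrable_on {0..T}"
  proof -
    let ?c = "M * (2 * K) * weight T"
    have "(\<lambda>s. ?c\<^sup>2 + (?N s)\<^sup>2 + 2 * ?c * ?N s) integrable_on {0..T}"
      by (intro integrable_add integrable_const_ivl integrable_on_mult_right fN L2_ell2_norm_facts(1)[OF f])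
    then show ?thesis by (simp add: NH_def power2_sum)
  qed
  define V where "V = (\<lambda>t k. u1 k + integral {0..t} (\<lambda>s. H s k))"
  have "ell2_majorised h T NH H"
    using Hint H2 HN NHint by (simp add: ell2_majorised_def)
  note V = ell2_const_add_primitive[OF this u1 V_def]
  define KV where "KV = ell2_norm h u1 + integral {0..T} NH"
  have V_le: "ell2_norm h (V t) \<le> KV" if "t \<in> {0..T}" for t
  proof -
    have "0 \<le> NH s" if "s \<in> {0..T}" for s
      using HN[OF that] ell2_norm_nonneg order_trans by blast
    then have "integral {0..t} NH \<le> integral {0..T} NH"
      using that integrable_subinterval_real[OF NHint, of 0 t] by (intro integral_subset_le NHint) auto
    then show ?thesis using V(3)[OF that] by (simp add: KV_def)
  qed
  have "ell2_majorised h T (\<lambda>s. KV) V"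
    using V V_le by (auto simp: ell2_majorised_def intro: integrable_continuous_real)
  note U = ell2_const_add_primitive(4)[OF this u0 refl integrable_const_ivl]
  have u_eq: "u t k = u0 k + integral {0..t} (\<lambda>s. V s k)" if t: "t \<in> {0..T}" and k: "k \<in> lattice_hZ h" for t k
  proof -
    have "integral {0..s} (\<lambda>r. H r k) = integral {0..s} (\<lambda>r. G r (u r) k) + integral {0..s} (\<lambda>r. f r k)"
      if "s \<in> {0..t}" for s
      unfolding H_def using that t
      by (intro integral_add integrable_subinterval_real[OF gint[OF k]] integrable_subinterval_real[OF fint[OF k]]) auto
    then have "integral {0..t} (\<lambda>s. V s k)
        = integral {0..t} (\<lambda>s. V1 s k + integral {0..s} (\<lambda>r. G r (u r) k))"
      by (intro integral_cong) (simp add: V_def V1_def)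
    also have "\<dots> = integral {0..t} (\<lambda>s. V1 s k) + volterra u t k"
      unfolding volterra_def using t
      by (intro integral_add integrable_continuous_real continuous_on_subset[OF V1(1)[OF k]]
          continuous_on_subset[OF indefinite_integral_continuous_1[OF gint[OF k]]]) auto
    finally show ?thesis
      using u(2) t k by (simp add: P_def)
  qed
  have der_u: "((\<lambda>s. u s k) has_vector_derivative V t k) (at t within {0..T})"
    if t: "t \<in> {0..T}" and k: "k \<in> lattice_hZ h" for t k
  proof -
    have "((\<lambda>t. u0 k + integral {0..t} (\<lambda>s. V s k)) has_vector_derivative 0 + V t k) (at t within {0..T})"
      by (intro has_vector_derivative_add has_vector_derivative_const integral_has_vector_derivative V(1) k t)
    then have "((\<lambda>t. u0 k + integral {0..t} (\<lambda>s. V s k)) has_vector_derivative V t k) (at t within {0..T})"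
      by simp
    then show ?thesis
      by (rule has_vector_derivative_transform[OF t, rotated]) (use u_eq k in auto)
  qed
  have ddt_u: "ddt T u t k = V t k" if "t \<in> {0..T}" "k \<in> lattice_hZ h" for t k
    by (rule ddt_eqI[where u = u and k = k, OF T_pos that(1) der_u[OF that]])
  have ae: "AE t in lebesgue_on {0..T}. \<forall>k\<in>lattice_hZ h.
      ((\<lambda>s. ddt T u s k) has_vector_derivative H t k) (at t within {0..T})"
  proof -
    have "\<forall>k\<in>lattice_hZ h. \<exists>N. negligible N \<and> (\<forall>t\<in>{0..T} - N.
        ((\<lambda>t. integral {0..t} (\<lambda>s. H s k)) has_vector_derivative H t k) (at t within {0..T}))"
      using indefinite_integral_has_vector_derivative_ae[OF Hint] by metis
    then obtain N where N: "\<And>k. k \<in> lattice_hZ h \<Longrightarrow> negligible (N k)"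
      "\<And>k t. k \<in> lattice_hZ h \<Longrightarrow> t \<in> {0..T} - N k \<Longrightarrow>
        ((\<lambda>t. integral {0..t} (\<lambda>s. H s k)) has_vector_derivative H t k) (at t within {0..T})"
      by metis
    show ?thesis
    proof (rule negligible_AE_lebesgue_on)
      show "negligible (\<Union> (N ` lattice_hZ h))"
        using N(1) countable_lattice_hZ by (intro negligible_countable_Union) auto
      fix t assume t: "t \<in> {0..T} - \<Union> (N ` lattice_hZ h)"
      show "\<forall>k\<in>lattice_hZ h. ((\<lambda>s. ddt T u s k) has_vector_derivative H t k) (at t within {0..T})"
      proof
        fix k :: "real ^ 'n" assume k: "k \<in> lattice_hZ h"
        have "((\<lambda>t. u1 k + integral {0..t} (\<lambda>s. H s k)) has_vector_derivative 0 + H t k) (at t within {0..T})"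
          using t k by (intro has_vector_derivative_add has_vector_derivative_const N(2)) auto
        then have "((\<lambda>t. V t k) has_vector_derivative H t k) (at t within {0..T})"
          by (simp add: V_def)
        then show "((\<lambda>s. ddt T u s k) has_vector_derivative H t k) (at t within {0..T})"
          by (rule has_vector_derivative_transform[rotated 2]) (use t k ddt_u in auto)
      qed
    qed simp
  qed
  have "solves u0 u1 f u"
    unfolding solves_def
  proof (intro conjI ballI)
    fix t assume t: "t \<in> {0..T}"
    show "(\<lambda>s. u s k) differentiable at t within {0..T}" if "k \<in> lattice_hZ h" for k
      using der_u[OF t that] by (rule differentiableI_vector)
    show "u t \<in> ell2 h" using u(1) t by (simp add: dominated_def)
    show "ddt T u t \<in> ell2 h"
      using ell2_cong[of h "ddt T u t" "V t"] ddt_u[OF t] V(2)[OF t] by blast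
  next
    show "ell2_absolutely_continuous h T u"
      by (rule ell2_absolutely_continuous_cong[OF _ U]) (use u_eq in auto)
    show "ell2_absolutely_continuous h T (ddt T u)"
      by (rule ell2_absolutely_continuous_cong[OF _ V(4)[OF NH2]]) (use ddt_u in auto)
    show "AE t in lebesgue_on {0..T}. \<forall>k\<in>lattice_hZ h.
        (\<lambda>s. ddt T u s k) differentiable (at t within {0..T}) \<and>
        ddt T (ddt T u) t k = G t (u t) k + f t k"
      using ae AE_space
    proof eventually_elim
      case (elim t)
      then have t: "t \<in> {0..T}" by simp
      show ?case
        using elim ddt_eqI[where u = "ddt T u", OF T_pos t]
        by (auto simp: H_def intro: differentiableI_vector)
    qed
  next
    fix k :: "real ^ 'n" assume k: "k \<in> lattice_hZ h"
    show "u 0 k = u0 k" "ddt T u 0 k = u1 k"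
      using u_eq[of 0 k] ddt_u[of 0 k] k T_pos by (auto simp: V_def)
  qed
  then show thesis by (rule that)
qed

end

section \<open>Uniqueness, continuous dependence and the quadratic estimate\<close>

context bounded_generator
begin

lemma solves_diff_bound:
  assumes "u0 \<in> ell2 h" "u1 \<in> ell2 h" "f \<in> L2_ell2 h T" "solves u0 u1 f u"
    and "w0 \<in> ell2 h" "w1 \<in> ell2 h" "g \<in> L2_ell2 h T" "solves w0 w1 g w"
    and t: "t \<in> {0..T}"
  shows "ell2_norm h (\<lambda>k. w t k - u t k) + ell2_norm h (\<lambda>k. ddt T w t k - ddt T u t k)
    \<le> growth * (ell2_norm h (\<lambda>k. w0 k - u0 k) + ell2_norm h (\<lambda>k. w1 k - u1 k)
        + sqrt T * L2_ell2_norm h T (\<lambda>t k. g t k - f t k))"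
proof -
  have "ell2_norm h (ddt T (\<lambda>t k. w t k - u t k) t) = ell2_norm h (\<lambda>k. ddt T w t k - ddt T u t k)"
    by (rule ell2_norm_cong) (rule solves_diff(2)[OF assms(4,8) t])
  then show ?thesis
    using energy_estimate[OF ell2_diff(1)[OF assms(5,1)] ell2_diff(1)[OF assms(6,2)]
        L2_ell2_diff[OF assms(3,7)] solves_diff(1)[OF assms(4,8)] t] by simp
qed

lemma growth_pos: "growth > 0"
  by (simp add: growth_def)

lemma solution_unique:
  assumes "u0 \<in> ell2 h" "u1 \<in> ell2 h" "f \<in> L2_ell2 h T" "solves u0 u1 f u" "solves u0 u1 f w"
    and t: "t \<in> {0..T}" and k: "k \<in> lattice_hZ h"
  shows "u t k = w t k"
proof -
  have "L2_ell2_norm h T (\<lambda>t k. f t k - f t k) = 0"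
    by (simp add: L2_ell2_norm_def)
  then have "ell2_norm h (\<lambda>k. w t k - u t k) + ell2_norm h (\<lambda>k. ddt T w t k - ddt T u t k) \<le> 0"
    using solves_diff_bound[OF assms(1-4) assms(1-3,5) t] by simp
  then have "ell2_norm h (\<lambda>k. w t k - u t k) \<le> 0"
    using ell2_norm_nonneg[of h "\<lambda>k. ddt T w t k - ddt T u t k"] by linarith
  moreover have "(\<lambda>k. w t k - u t k) \<in> ell2 h"
    using assms(4,5) t unfolding solves_def by (intro ell2_diff) auto
  ultimately have "cmod (w t k - u t k) \<le> 0"
    using cmod_le_ell2_norm[OF _ k, of "\<lambda>k. w t k - u t k"] by linarith
  then show ?thesis by simp
qed

lemma solution_continuous:
  assumes "u0 \<in> ell2 h" "u1 \<in> ell2 h" "f \<in> L2_ell2 h T" "solves u0 u1 f u" and "\<epsilon> > 0"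
  shows "\<exists>\<delta>>0. \<forall>w0 w1 g w. w0 \<in> ell2 h \<longrightarrow> w1 \<in> ell2 h \<longrightarrow> g \<in> L2_ell2 h T \<longrightarrow> solves w0 w1 g w \<longrightarrow>
      ell2_norm h (\<lambda>k. w0 k - u0 k) + ell2_norm h (\<lambda>k. w1 k - u1 k)
        + L2_ell2_norm h T (\<lambda>t k. g t k - f t k) < \<delta> \<longrightarrow>
      (\<forall>t\<in>{0..T}. ell2_norm h (\<lambda>k. w t k - u t k) + ell2_norm h (\<lambda>k. ddt T w t k - ddt T u t k) < \<epsilon>)"
proof (intro exI[of _ "\<epsilon> / (growth * (1 + sqrt T))"] conjI allI impI ballI)
  have pos: "growth * (1 + sqrt T) > 0"
    using growth_pos T_pos by (intro mult_pos_pos) (auto simp: add_pos_nonneg)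
  then show "\<epsilon> / (growth * (1 + sqrt T)) > 0"
    using \<open>\<epsilon> > 0\<close> by simp
  fix w0 w1 g w t
  assume w: "w0 \<in> ell2 h" "w1 \<in> ell2 h" "g \<in> L2_ell2 h T" "solves w0 w1 g w" and t: "t \<in> {0..T}"
  let ?p = "ell2_norm h (\<lambda>k. w0 k - u0 k) + ell2_norm h (\<lambda>k. w1 k - u1 k)"
    and ?q = "L2_ell2_norm h T (\<lambda>t k. g t k - f t k)"
  assume close: "?p + ?q < \<epsilon> / (growth * (1 + sqrt T))"
  have q: "?q \<ge> 0" by (simp add: L2_ell2_norm_def)
  have "?p + sqrt T * ?q \<le> (1 + sqrt T) * (?p + ?q)"
    using T_pos q by (simp add: algebra_simps)
  then have "growth * (?p + sqrt T * ?q) \<le> growth * ((1 + sqrt T) * (?p + ?q))"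
    using growth_pos by simp
  also have "\<dots> < \<epsilon>"
    using close pos by (simp add: pos_less_divide_eq mult.commute mult.left_commute)
  finally show "ell2_norm h (\<lambda>k. w t k - u t k) + ell2_norm h (\<lambda>k. ddt T w t k - ddt T u t k) < \<epsilon>"
    using solves_diff_bound[OF assms(1-4) w t] by simp
qed

lemma square_energy_estimate:
  assumes "u0 \<in> ell2 h" "u1 \<in> ell2 h" "f \<in> L2_ell2 h T" "solves u0 u1 f u" "t \<in> {0..T}"
  shows "(ell2_norm h (u t))\<^sup>2 + (ell2_norm h (ddt T u t))\<^sup>2
    \<le> 3 * growth\<^sup>2 * (1 + T) * ((ell2_norm h u0)\<^sup>2 + (ell2_norm h u1)\<^sup>2 + (L2_ell2_norm h T f)\<^sup>2)"
proof -
  let ?x = "ell2_norm h (u t)" and ?y = "ell2_norm h (ddt T u t)"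
  let ?p = "ell2_norm h u0" and ?q = "ell2_norm h u1" and ?r = "L2_ell2_norm h T f"
  have "?x\<^sup>2 + ?y\<^sup>2 \<le> (?x + ?y)\<^sup>2"
    by (simp add: power2_sum)
  also have "\<dots> \<le> (growth * (?p + ?q + sqrt T * ?r))\<^sup>2"
    using energy_estimate[OF assms] by (intro power_mono) auto
  also have "\<dots> = growth\<^sup>2 * (?p + ?q + sqrt T * ?r)\<^sup>2"
    by (rule power_mult_distrib)
  also have "\<dots> \<le> growth\<^sup>2 * (3 * (1 + T) * (?p\<^sup>2 + ?q\<^sup>2 + ?r\<^sup>2))"
  proof (rule mult_left_mono)
    have sq: "(a + b + c)\<^sup>2 \<le> 3 * (a\<^sup>2 + b\<^sup>2 + c\<^sup>2)" for a b c :: real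
      using sum_squares_bound[of a b] sum_squares_bound[of a c] sum_squares_bound[of b c]
      by (simp add: power2_eq_square algebra_simps)
    have "(?p + ?q + sqrt T * ?r)\<^sup>2 \<le> 3 * (?p\<^sup>2 + ?q\<^sup>2 + T * ?r\<^sup>2)"
      using sq[of ?p ?q "sqrt T * ?r"] T_pos by (simp add: power_mult_distrib)
    also have "\<dots> \<le> 3 * (1 + T) * (?p\<^sup>2 + ?q\<^sup>2 + ?r\<^sup>2)"
      using T_pos by (simp add: algebra_simps)
    finally show "(?p + ?q + sqrt T * ?r)\<^sup>2 \<le> 3 * (1 + T) * (?p\<^sup>2 + ?q\<^sup>2 + ?r\<^sup>2)" .
  qed simp
  also have "\<dots> = 3 * growth\<^sup>2 * (1 + T) * (?p\<^sup>2 + ?q\<^sup>2 + ?r\<^sup>2)"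
    by (simp only: mult.assoc mult.left_commute)
  finally show ?thesis .
qed

end

section \<open>The wave equation on the lattice\<close>

lemma hoelder_cond_continuous_on:
  assumes "hoelder_cond \<alpha> T a" "\<alpha> > 0"
  shows "continuous_on {0..T} a"
proof -
  obtain L where L: "\<And>t s. t \<in> {0..T} \<Longrightarrow> s \<in> {0..T} \<Longrightarrow> \<bar>a t - a s\<bar> \<le> L * \<bar>t - s\<bar> powr \<alpha>"
    using assms(1) unfolding hoelder_cond_def by blast
  show ?thesis
    unfolding continuous_on_iff
  proof (intro ballI allI impI)
    fix t \<epsilon> :: real assume t: "t \<in> {0..T}" and "\<epsilon> > 0"
    define \<eta> where "\<eta> = \<epsilon> / (\<bar>L\<bar> + 1)"
    have "\<eta> > 0" using \<open>\<epsilon> > 0\<close> by (simp add: \<eta>_def)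
    show "\<exists>d>0. \<forall>s\<in>{0..T}. dist s t < d \<longrightarrow> dist (a s) (a t) < \<epsilon>"
    proof (intro exI[of _ "\<eta> powr (1 / \<alpha>)"] conjI ballI impI)
      fix s assume s: "s \<in> {0..T}" "dist s t < \<eta> powr (1 / \<alpha>)"
      have "\<bar>s - t\<bar> powr \<alpha> < (\<eta> powr (1 / \<alpha>)) powr \<alpha>"
        using s assms(2) by (intro powr_less_mono2) (auto simp: dist_real_def)
      also have "\<dots> = \<eta>"
        using assms(2) \<open>\<eta> > 0\<close> by (simp add: powr_powr)
      finally have small: "\<bar>s - t\<bar> powr \<alpha> < \<eta>" .
      have "\<bar>a s - a t\<bar> \<le> \<bar>L\<bar> * \<bar>s - t\<bar> powr \<alpha>"
        using L[OF s(1) t] abs_ge_self[of L] by (meson mult_right_mono order_trans powr_ge_zero)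
      also have "\<dots> \<le> (\<bar>L\<bar> + 1) * \<bar>s - t\<bar> powr \<alpha>"
        by (intro mult_right_mono) auto
      also have "\<dots> < (\<bar>L\<bar> + 1) * \<eta>"
        using small by (intro mult_strict_left_mono) auto
      also have "\<dots> = \<epsilon>"
        by (simp add: \<eta>_def)
      finally show "dist (a s) (a t) < \<epsilon>"
        by (simp add: dist_real_def)
    qed (use \<open>\<eta> > 0\<close> in simp)
  qed
qed

lemma hoelder_class_continuous_on:
  assumes "hoelder_class \<alpha> T a" "\<alpha> > 0"
  shows "continuous_on {0..T} a"
proof (cases "\<alpha> \<le> 1")
  case True
  then show ?thesis
    using assms hoelder_cond_continuous_on by (simp add: hoelder_class_def)
next
  case False
  then obtain a' where "\<forall>t\<in>{0..T}. (a has_real_derivative a' t) (at t within {0..T})"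
    using assms by (auto simp: hoelder_class_def)
  then show ?thesis
    by (intro DERIV_continuous_on) auto
qed

lemma C_class_continuous_on:
  assumes "C_class l T a" "l \<ge> 1"
  shows "continuous_on {0..T} a"
proof -
  obtain d where d: "\<forall>t\<in>{0..T}. d 0 t = a t"
    "\<forall>i<l. \<forall>t\<in>{0..T}. (d i has_real_derivative d (Suc i) t) (at t within {0..T})"
    using assms(1) unfolding C_class_def by blast
  then have "continuous_on {0..T} (d 0)"
    using assms(2) by (intro DERIV_continuous_on[where D="d 1"]) auto
  then show ?thesis
    using continuous_on_cong[of "{0..T}" "{0..T}" "d 0" a] d(1) by simp
qed

definition wave_generator ::
    "real \<Rightarrow> (real \<Rightarrow> real) \<Rightarrow> (real \<Rightarrow> real) \<Rightarrow> real \<Rightarrow> (real ^ 'n \<Rightarrow> complex) \<Rightarrow> real ^ 'n \<Rightarrow> complex" where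
  "wave_generator h a b t x k =
     of_real (a t / h\<^sup>2) * discrete_laplacian h x k - of_real (b t) * x k"

lemma bounded_generator_wave:
  assumes "T > 0" and a: "continuous_on {0..T} a"
    and b: "b \<in> borel_measurable (lebesgue_on {0..T})" "\<And>t. t \<in> {0..T} \<Longrightarrow> \<bar>b t\<bar> \<le> B"
  obtains M where "bounded_generator h T M
    (wave_generator h a b :: real \<Rightarrow> (real ^ 'n \<Rightarrow> complex) \<Rightarrow> real ^ 'n \<Rightarrow> complex)"
proof -
  have a': "continuous_on {0..T} (\<lambda>t. a t / h\<^sup>2)"
    using continuous_on_mult_right[OF a, of "inverse (h\<^sup>2)"] by (simp add: divide_inverse)
  then have "bounded ((\<lambda>t. a t / h\<^sup>2) ` {0..T})"
    by (intro compact_imp_bounded compact_continuous_image) auto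
  then obtain A where A: "\<And>t. t \<in> {0..T} \<Longrightarrow> \<bar>a t / h\<^sup>2\<bar> \<le> A"
    unfolding bounded_iff by fastforce
  have A0: "A \<ge> 0" and B0: "B \<ge> 0"
    using A[of 0] b(2)[of 0] \<open>T > 0\<close> abs_ge_zero order_trans by (metis atLeastAtMost_iff less_eq_real_def)+
  show thesis
  proof (rule that[of "A * (4 * real CARD('n)) + B"], unfold_locales)
    show "T > 0" by fact
    show "A * (4 * real CARD('n)) + B \<ge> 0" using A0 B0 by simp
  next
    fix t and x :: "real ^ 'n \<Rightarrow> complex"
    assume t: "t \<in> {0..T}" and x: "x \<in> ell2 h"
    note L = discrete_laplacian_bounded[OF x]
    note 1 = ell2_mult[OF L(1), of "of_real (a t / h\<^sup>2)"]
    note 2 = ell2_mult[OF x, of "of_real (b t)"]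
    have eq: "wave_generator h a b t x
        = (\<lambda>k. of_real (a t / h\<^sup>2) * discrete_laplacian h x k - of_real (b t) * x k)"
      by (simp add: wave_generator_def fun_eq_iff)
    show "wave_generator h a b t x \<in> ell2 h"
      unfolding eq by (rule ell2_diff(1)[OF 1(1) 2(1)])
    have "ell2_norm h (wave_generator h a b t x)
        \<le> \<bar>a t / h\<^sup>2\<bar> * ell2_norm h (discrete_laplacian h x) + \<bar>b t\<bar> * ell2_norm h x"
      unfolding eq using ell2_diff(2)[OF 1(1) 2(1)] 1(2) 2(2) unfolding norm_of_real by linarith
    also have "\<dots> \<le> A * (4 * real CARD('n) * ell2_norm h x) + B * ell2_norm h x"
      using A[OF t] b(2)[OF t] L(2) A0 by (intro add_mono mult_mono) auto
    also have "\<dots> = (A * (4 * real CARD('n)) + B) * ell2_norm h x"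
      by (simp add: algebra_simps)
    finally show "ell2_norm h (wave_generator h a b t x) \<le> (A * (4 * real CARD('n)) + B) * ell2_norm h x" .
  next
    fix t and x y :: "real ^ 'n \<Rightarrow> complex" and k
    show "wave_generator h a b t (\<lambda>k. x k - y k) k = wave_generator h a b t x k - wave_generator h a b t y k"
      by (simp add: wave_generator_def discrete_laplacian_def algebra_simps sum.distrib sum_subtractf)
  next
    fix x :: "real \<Rightarrow> real ^ 'n \<Rightarrow> complex" and k :: "real ^ 'n"
    assume x: "\<And>k. k \<in> lattice_hZ h \<Longrightarrow> continuous_on {0..T} (\<lambda>t. x t k)" and k: "k \<in> lattice_hZ h"
    have "continuous_on {0..T} (\<lambda>t. of_real (a t / h\<^sup>2) * discrete_laplacian h (x t) k)"
      unfolding discrete_laplacian_def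
      by (intro continuous_intros x lattice_hZ_shift k continuous_on_of_real a')
    then have "(\<lambda>t. of_real (a t / h\<^sup>2) * discrete_laplacian h (x t) k) \<in> borel_measurable (lebesgue_on {0..T})"
      by (intro continuous_imp_measurable_on_sets_lebesgue) auto
    moreover have "(\<lambda>t. x t k) \<in> borel_measurable (lebesgue_on {0..T})"
      using x[OF k] by (intro continuous_imp_measurable_on_sets_lebesgue) auto
    ultimately show "(\<lambda>t. wave_generator h a b t (x t) k) \<in> borel_measurable (lebesgue_on {0..T})"
      unfolding wave_generator_def using b(1) by measurable
  qed
qed

text \<open>The equation is required for almost every time, so the potential may be changed on a null set.
  This lets an essentially bounded potential be replaced by a bounded one.\<close>

lemma ell2_solution_iff_solves:
  fixes u :: "real \<Rightarrow> real ^ 'n \<Rightarrow> complex"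
  assumes gen: "bounded_generator h T M (wave_generator h a b' :: real \<Rightarrow> (real ^ 'n \<Rightarrow> complex) \<Rightarrow> _)"
    and b: "AE t in lebesgue_on {0..T}. b' t = b t"
  shows "ell2_solution h T a b u0 u1 f u \<longleftrightarrow> bounded_generator.solves h T (wave_generator h a b') u0 u1 f u"
proof -
  have eq: "(v - of_real (a t / h\<^sup>2) * discrete_laplacian h (u t) k + of_real (b t) * u t k = f t k)
      = (v = wave_generator h a b' t (u t) k + f t k)" if "b' t = b t" for t k v
    using that by (auto simp: wave_generator_def algebra_simps)
  have "(AE t in lebesgue_on {0..T}. \<forall>k\<in>lattice_hZ h.
        (\<lambda>s. ddt T u s k) differentiable (at t within {0..T}) \<and>
        ddt T (ddt T u) t k - of_real (a t / h\<^sup>2) * discrete_laplacian h (u t) k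
          + of_real (b t) * u t k = f t k)
    \<longleftrightarrow> (AE t in lebesgue_on {0..T}. \<forall>k\<in>lattice_hZ h.
        (\<lambda>s. ddt T u s k) differentiable (at t within {0..T}) \<and>
        ddt T (ddt T u) t k = wave_generator h a b' t (u t) k + f t k)"
    by (rule eventually_cong[OF b]) (use eq in simp)
  then show ?thesis
    unfolding ell2_solution_def bounded_generator.solves_def[OF gen] by simp
qed

theorem theorem1p1:
  fixes T :: real and a b :: "real \<Rightarrow> real"
  assumes T: "T > 0"
    and b: "L_infinity T b" "\<forall>t\<in>{0..T}. b t \<ge> 0"
    and a: "(Lip_class T a \<and> positive_minimum T a)
          \<or> (\<exists>\<alpha>. 0 < \<alpha> \<and> \<alpha> < 1 \<and> hoelder_class \<alpha> T a \<and> positive_minimum T a)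
          \<or> (\<exists>l\<ge>2. C_class l T a \<and> (\<forall>t\<in>{0..T}. a t \<ge> 0))
          \<or> (\<exists>\<alpha>. 0 < \<alpha> \<and> \<alpha> < 2 \<and> hoelder_class \<alpha> T a \<and> (\<forall>t\<in>{0..T}. a t \<ge> 0))"
  shows "\<forall>h>0.
     ell2_well_posed TYPE('n::finite) h T a b \<and>
     (\<forall>(u0 :: real ^ 'n \<Rightarrow> complex) u1 f u.
        u0 \<in> ell2 h \<longrightarrow> u1 \<in> ell2 h \<longrightarrow> f \<in> L2_ell2 h T \<longrightarrow>
        ell2_solution h T a b u0 u1 f u \<longrightarrow>
        (\<forall>t\<in>{0..T}. u t \<in> ell2 h \<and> ddt T u t \<in> ell2 h)) \<and>
     (\<exists>C>0. \<forall>(u0 :: real ^ 'n \<Rightarrow> complex) u1 f u.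
        u0 \<in> ell2 h \<longrightarrow> u1 \<in> ell2 h \<longrightarrow> f \<in> L2_ell2 h T \<longrightarrow>
        ell2_solution h T a b u0 u1 f u \<longrightarrow>
        (\<forall>t\<in>{0..T}. (ell2_norm h (u t))\<^sup>2 + (ell2_norm h (ddt T u t))\<^sup>2
           \<le> C * ((ell2_norm h u0)\<^sup>2 + (ell2_norm h u1)\<^sup>2 + (L2_ell2_norm h T f)\<^sup>2)))"
proof (intro allI impI)
  fix h :: real assume "h > 0"
  have cont: "continuous_on {0..T} a"
    using a hoelder_class_continuous_on C_class_continuous_on lipschitz_on_continuous_on
    by (fastforce simp: Lip_class_def)
  obtain B where B: "AE t in lebesgue_on {0..T}. \<bar>b t\<bar> \<le> B"
    and bm: "b \<in> borel_measurable (lebesgue_on {0..T})"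
    using b(1) by (auto simp: L_infinity_def)
  \<comment> \<open>Clipping gives a bound at every time and changes the potential on a null set only.\<close>
  define b' where "b' t = max (- \<bar>B\<bar>) (min \<bar>B\<bar> (b t))" for t
  have "b' \<in> borel_measurable (lebesgue_on {0..T})"
    unfolding b'_def using bm by measurable
  moreover have "\<bar>b' t\<bar> \<le> \<bar>B\<bar>" for t
    by (auto simp: b'_def)
  ultimately obtain M where gen: "bounded_generator h T M
      (wave_generator h a b' :: real \<Rightarrow> (real ^ 'n \<Rightarrow> complex) \<Rightarrow> real ^ 'n \<Rightarrow> complex)"
    using bounded_generator_wave[OF T cont] by metis
  have ae: "AE t in lebesgue_on {0..T}. b' t = b t"
    using B by eventually_elim (auto simp: b'_def)
  interpret bounded_generator h T M "wave_generator h a b' :: real \<Rightarrow> (real ^ 'n \<Rightarrow> complex) \<Rightarrow> _"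
    by (rule gen)
  note sol = ell2_solution_iff_solves[OF gen ae]
  have "ell2_well_posed TYPE('n) h T a b"
    unfolding ell2_well_posed_def sol
  proof (intro conjI allI impI ballI, goal_cases)
    case (1 u0 u1 f)
    then show ?case using solution_exists[of u0 u1 f] by blast
  next
    case (2 u0 u1 f u w t k)
    then show ?case by (rule solution_unique)
  next
    case (3 u0 u1 f u \<epsilon>)
    then show ?case by (rule solution_continuous)
  qed
  moreover have "\<forall>t\<in>{0..T}. u t \<in> ell2 h \<and> ddt T u t \<in> ell2 h"
    if "solves u0 u1 f u" for u0 u1 f u
    using that by (simp add: solves_def)
  moreover have "3 * growth\<^sup>2 * (1 + T) > 0"
    using growth_pos T by (intro mult_pos_pos) auto
  ultimately show "ell2_well_posed TYPE('n::finite) h T a b \<and>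
     (\<forall>(u0 :: real ^ 'n \<Rightarrow> complex) u1 f u.
        u0 \<in> ell2 h \<longrightarrow> u1 \<in> ell2 h \<longrightarrow> f \<in> L2_ell2 h T \<longrightarrow>
        ell2_solution h T a b u0 u1 f u \<longrightarrow>
        (\<forall>t\<in>{0..T}. u t \<in> ell2 h \<and> ddt T u t \<in> ell2 h)) \<and>
     (\<exists>C>0. \<forall>(u0 :: real ^ 'n \<Rightarrow> complex) u1 f u.
        u0 \<in> ell2 h \<longrightarrow> u1 \<in> ell2 h \<longrightarrow> f \<in> L2_ell2 h T \<longrightarrow>
        ell2_solution h T a b u0 u1 f u \<longrightarrow>
        (\<forall>t\<in>{0..T}. (ell2_norm h (u t))\<^sup>2 + (ell2_norm h (ddt T u t))\<^sup>2
           \<le> C * ((ell2_norm h u0)\<^sup>2 + (ell2_norm h u1)\<^sup>2 + (L2_ell2_norm h T f)\<^sup>2)))"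
    unfolding sol
    by (intro conjI exI[of _ "3 * growth\<^sup>2 * (1 + T)"] allI impI ballI square_energy_estimate) auto
qed

end
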